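(* Let $(\Omega,\mathcal F,\mathbb P)$ be a probability space and let $f_1,f_2,\dots$ be real-valued measurable functions on $\Omega$. (i) Suppose that for some subsequence $(f_{k_n})_{n\in\mathbb N}$ and some sets $A_1\subseteq A_2\subseteq\cdots$ in $\mathcal F$ with $\lim_{j\to\infty}\mathbb P(A_j)=1$ we have, for every $j\in\mathbb N$, $\sup_{n\in\mathbb N}\mathbb E^{\mathbb P}\big(|f_{k_n}|\mathbf 1_{A_j}\big)<\infty$. Then there exist a measurable function $f_*:\Omega\to\mathbb R$ and a further subsequence $(f_{k'_n})_{n}$ of $(f_{k_n})_n$ such that, for $(f_{k'_n})_n$ and for every subsequence $(f_{m_n})_n$ of it, $\lim_{N\to\infty}\frac1N\sum_{n=1}^N f_{m_n}=f_*$ holds $\mathbb P$-a.e. (ii) Conversely, suppose that for some subsequence $(f_{k_n})_n$ and some measurable $f_*:\Omega\to\mathbb R$, along $(f_{k_n})_n$ and along each of its subsequences $(f_{m_n})_n$ we have $\lim_{N\to\infty}\frac1N\sum_{n=1}^N f_{m_n}=f_*$ $\mathbb P$-a.e. Then there exist sets $A_1\subseteq A_2\subseteq\cdots$ in $\mathcal F$ with $\lim_{j\to\infty}\mathbb P(A_j)=1$ and a subsequence $(f_{k'_n})_n$ of $(f_{k_n})_n$ such that $\sup_{n\in\mathbb N}\mathbb E^{\mathbb P}\big(|f_{k'_n}|\mathbf 1_{A_j}\big)<\infty$ for every $j\in\mathbb N$. (iii) The following are equivalent: (a) there exist a subsequence $(f_{k_n})_n$ and sets $A_1\subseteq A_2\subseteq\cdots$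 in $\mathcal F$ with $\lim_j\mathbb P(A_j)=1$ such that $\sup_n\mathbb E^{\mathbb P}(|f_{k_n}|\mathbf 1_{A_j})<\infty$ for every $j$; (b) there exist a probability measure $\mathbb Q$ on $(\Omega,\mathcal F)$ equivalent to $\mathbb P$ and a subsequence $(f_{k_n})_n$ which is bounded in $L^1(\mathbb Q)$, i.e. $\sup_n\mathbb E^{\mathbb Q}(|f_{k_n}|)<\infty$. *)

theory Defs
  imports "HOL-Probability.Probability"
begin

definition loc_L1_bounded :: "'a measure \<Rightarrow> (nat \<Rightarrow> 'a \<Rightarrow> real) \<Rightarrow> (nat \<Rightarrow> 'a set) \<Rightarrow> bool" where
  "loc_L1_bounded M g A \<longleftrightarrow>
     (\<forall>j. (SUP n. \<integral>\<^sup>+ x. ennreal (\<bar>g n x\<bar> * indicator (A j) x) \<partial>M) < \<infinity>)"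

definition exhausting_seq :: "'a measure \<Rightarrow> (nat \<Rightarrow> 'a set) \<Rightarrow> bool" where
  "exhausting_seq M A \<longleftrightarrow> range A \<subseteq> sets M \<and> incseq A \<and> (\<lambda>j. measure M (A j)) \<longlonglongrightarrow> 1"

definition cesaro_ae :: "'a measure \<Rightarrow> (nat \<Rightarrow> 'a \<Rightarrow> real) \<Rightarrow> ('a \<Rightarrow> real) \<Rightarrow> bool" where
  "cesaro_ae M g h \<longleftrightarrow> (AE x in M. (\<lambda>N. (\<Sum>n<N. g n x) / real N) \<longlonglongrightarrow> h x)"

definition equiv_prob :: "'a measure \<Rightarrow> 'a measure \<Rightarrow> bool" where
  "equiv_prob M Q \<longleftrightarrow> prob_space Q \<and> space Q = space M \<and> sets Q = sets M \<and>
     (\<forall>B\<in>sets M. emeasure M B = 0 \<longleftrightarrow> emeasure Q B = 0)"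

end

theory Submission
  imports Defs "HOL-Library.Diagonal_Subsequence"
begin

text \<open>
  The local boundedness condition is the same as boundedness in \<open>L\<^sup>1(Q)\<close> for an equivalent \<open>Q\<close>: in one
  direction \<open>Q\<close> has a density that is a suitable multiple of \<open>\<Sum>\<^sub>j 2\<^sup>-\<^sup>j (1 + K\<^sub>j)\<^sup>-\<^sup>1 1\<^bsub>A\<^sub>j\<^esub>\<close>, in the other one takes
  \<open>A\<^sub>j = {dP/dQ \<le> j}\<close>. So part (i) is Komlos's theorem. Weak limits of bounded sequences come from a
  subsequence with an almost constant Gram matrix, whose averages converge in mean square. For
  nonnegative functions, truncation, subtraction of the weak limits and a diagonal choice produce
  almost orthogonal terms, and Etemadi's monotonicity argument needs nothing more.

  For part (ii) let \<open>p\<^sub>c\<close> be the weak limit of the indicators of \<open>{|f\<^sub>n| \<ge> c}\<close>. If \<open>\<Sum>\<^sub>c p\<^sub>c\<close> diverged on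
  a set of positive measure, a sparse subsequence would satisfy \<open>|f\<^bsub>m\<^sub>n\<^esub>| \<ge> n\<close> infinitely often there,
  contradicting the convergence of its averages. So the sum is finite almost everywhere, and it bounds the
  limiting truncated moments on its sublevel sets.
\<close>

section \<open>Subsequences and averages\<close>

text \<open>The subsequence in part (i) has to serve all of its uncountably many subsequences, so
  the estimates cannot be tied to the position of a term: a function chosen at stage t may later
  stand in any place n \<le> t and be truncated accordingly. What replaces identical distribution is
  the limit \<open>u n\<close>, along the sequence, of E min(f, n+1)^2 / (n+1)^2. For a single
  nonnegative f these quantities sum to at most 3 E f, and the bound passes to the limits, so
  \<open>u\<close> is summable. The limit function is the increasing limit of the weak limits of the
  truncations. Signs are split because the partial sums have to be monotone.

  In part (ii) no integrability is given, so weak limits are taken of threshold indicators only.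
  Counting the thresholds that a function passes recovers its size up to 1, but a single choice can
  follow only finitely many thresholds. Hence the n-th function is followed up to a level that it
  exceeds with probability below 2^-n, and the sets A_j cap the exceptions.\<close>

lemma strict_mono_select:
  fixes P :: "nat \<Rightarrow> (nat \<Rightarrow> nat) \<Rightarrow> nat \<Rightarrow> bool"
  assumes cong: "\<And>t \<rho> \<rho>' m. (\<And>i. i < t \<Longrightarrow> \<rho> i = \<rho>' i) \<Longrightarrow> P t \<rho> m \<longleftrightarrow> P t \<rho>' m"
    and ev: "\<And>t \<rho>. eventually (P t \<rho>) sequentially"
  obtains r :: "nat \<Rightarrow> nat" where "strict_mono r" "\<And>t. P t r (r t)"
proof -
  \<comment> \<open>By \<open>cong\<close>, condition t looks only at values chosen before stage t,
    as dependent choice along the well-order requires. Asking for all large m, not just one, lets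
    strict monotonicity be added to any condition.\<close>
  have "\<exists>r. \<forall>t. (\<forall>i<t. r i < r t) \<and> P t r (r t)"
  proof (rule dependent_wellorder_choice)
    show "(\<forall>i<t. \<rho> i < m) \<and> P t \<rho> m \<longleftrightarrow> (\<forall>i<t. \<rho>' i < m) \<and> P t \<rho>' m"
      if "\<And>y. y < t \<Longrightarrow> \<rho> y = \<rho>' y" for m \<rho> \<rho>' t
      using cong[of t \<rho> \<rho>' m] that by auto
  next
    fix t :: nat and \<rho> :: "nat \<Rightarrow> nat"
    have "eventually (\<lambda>m. \<forall>i\<in>{..<t}. \<rho> i < m) sequentially"
      by (intro eventually_ball_finite) (auto intro: eventually_gt_at_top)
    with ev[of t \<rho>] have "eventually (\<lambda>m. (\<forall>i<t. \<rho> i < m) \<and> P t \<rho> m) sequentially"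
      by eventually_elim auto
    then show "\<exists>m. (\<forall>i<t. \<rho> i < m) \<and> P t \<rho> m"
      by (auto dest: eventually_happens)
  qed
  then show ?thesis
    by (metis that strict_monoI)
qed

lemma diagonal_convergent_subseq:
  fixes c :: "nat \<Rightarrow> nat \<Rightarrow> real"
  assumes "\<And>i. Bseq (c i)"
  obtains r :: "nat \<Rightarrow> nat" where "strict_mono r" "\<And>i. convergent (\<lambda>n. c i (r n))"
proof -
  interpret subseqs "\<lambda>i s. convergent (\<lambda>n. c i (s n))"
  proof
    fix n and s :: "nat \<Rightarrow> nat"
    assume "strict_mono s"
    from assms[of n] have "bounded (range (\<lambda>m. c n (s m)))"
      by (auto simp: Bseq_eq_bounded elim!: bounded_subset)
    then obtain l r where "strict_mono r" "((\<lambda>m. c n (s m)) \<circ> r) \<longlonglongrightarrow> l"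
      using bounded_imp_convergent_subsequence by blast
    then show "\<exists>r. strict_mono r \<and> convergent (\<lambda>m. c n ((s \<circ> r) m))"
      by (auto simp: convergent_def o_def)
  qed
  have "convergent (\<lambda>n. c i (diagseq n))" for i
  proof -
    \<comment> \<open>The diagonal sequence follows the i-th refinement only after its first
      \<open>Suc i\<close> terms are dropped; the limit does not see the shift.\<close>
    have "convergent (\<lambda>n. c i ((diagseq \<circ> ((+) (Suc i))) n))"
      by (rule diagseq_holds) (auto intro: convergent_subseq_convergent[unfolded o_def])
    then show ?thesis
      using convergent_ignore_initial_segment[of "\<lambda>n. c i (diagseq n)" "Suc i"] by (simp add: add.commute)
  qed
  then show ?thesis
    using that subseq_diagseq by blast
qed

lemma cesaro_tendsto:
  fixes a :: "nat \<Rightarrow> real"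
  assumes "a \<longlonglongrightarrow> l"
  shows "(\<lambda>N. (\<Sum>n<N. a n) / real N) \<longlonglongrightarrow> l"
proof (rule LIMSEQ_I)
  fix e :: real assume "e > 0"
  then obtain n0 where n0: "\<And>n. n \<ge> n0 \<Longrightarrow> \<bar>a n - l\<bar> < e / 2"
    using LIMSEQ_D[OF assms, of "e / 2"] by auto
  define K where "K = (\<Sum>n<n0. \<bar>a n - l\<bar>)"
  obtain n1 :: nat where n1: "real n1 > 2 * K / e" using reals_Archimedean2 by blast
  have "\<bar>(\<Sum>n<N. a n) / real N - l\<bar> < e" if N: "N \<ge> max (max n0 n1) 1" for N
  proof -
    have "(\<Sum>n<N. a n) / real N - l = (\<Sum>n<N. a n - l) / real N"
      using N by (simp add: sum_subtractf field_simps)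
    moreover have "\<bar>\<Sum>n<N. a n - l\<bar> \<le> (\<Sum>n<N. \<bar>a n - l\<bar>)"
      by (rule sum_abs)
    moreover have "(\<Sum>n<N. \<bar>a n - l\<bar>) = K + (\<Sum>n=n0..<N. \<bar>a n - l\<bar>)"
      unfolding K_def lessThan_atLeast0 using N by (subst sum.atLeastLessThan_concat) auto
    moreover have "(\<Sum>n=n0..<N. \<bar>a n - l\<bar>) \<le> (\<Sum>n=n0..<N. e / 2)"
      by (rule sum_mono) (use n0 in \<open>auto intro: less_imp_le\<close>)
    moreover have "(\<Sum>n=n0..<N. e / 2) \<le> real N * (e / 2)"
      using \<open>e > 0\<close> by (auto intro!: divide_right_mono mult_right_mono)
    moreover have "K < real N * (e / 2)"
    proof -
      have "2 * K / e < real N" using n1 N by simp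
      then show ?thesis using \<open>e > 0\<close> by (simp add: field_simps)
    qed
    ultimately have "\<bar>\<Sum>n<N. a n - l\<bar> < real N * e"
      by (simp add: field_simps)
    then have "\<bar>\<Sum>n<N. a n - l\<bar> / real N < e"
      using N by (simp add: field_simps)
    then show ?thesis
      using \<open>(\<Sum>n<N. a n) / real N - l = _\<close> by simp
  qed
  then show "\<exists>no. \<forall>n\<ge>no. norm ((\<Sum>n<n. a n) / real n - l) < e"
    by (metis real_norm_def)
qed

text \<open>A term divided by its position is the difference of two consecutive averages, the
  earlier one rescaled by N / (N + 1). In part (ii) this turns convergence of averages into a growth
  bound on single terms.\<close>

lemma cesaro_tendsto_imp_term_0:
  fixes a :: "nat \<Rightarrow> real"
  assumes "(\<lambda>N. (\<Sum>n<N. a n) / real N) \<longlonglongrightarrow> l"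
  shows "(\<lambda>n. a n / real (Suc n)) \<longlonglongrightarrow> 0"
proof -
  have "(\<lambda>N. (\<Sum>n<Suc N. a n) / real (Suc N) - (\<Sum>n<N. a n) / real N * (real N / real (Suc N)))
          \<longlonglongrightarrow> l - l * 1"
    by (intro tendsto_diff tendsto_mult assms LIMSEQ_Suc[OF assms]) (rule LIMSEQ_n_over_Suc_n)
  moreover have "(\<Sum>n<Suc N. a n) / real (Suc N) - (\<Sum>n<N. a n) / real N * (real N / real (Suc N))
      = a N / real (Suc N)" for N
    by (cases "N = 0") (simp_all add: add_divide_distrib)
  ultimately show ?thesis by simp
qed

lemma cesaro_tendsto_cong:
  fixes a b :: "nat \<Rightarrow> real"
  assumes "eventually (\<lambda>n. a n = b n) sequentially"
    and "(\<lambda>N. (\<Sum>n<N. a n) / real N) \<longlonglongrightarrow> l"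
  shows "(\<lambda>N. (\<Sum>n<N. b n) / real N) \<longlonglongrightarrow> l"
proof -
  have "(\<lambda>n. b n - a n) \<longlonglongrightarrow> 0"
    using assms(1) by (intro tendsto_eventually) (auto elim: eventually_mono)
  then have "(\<lambda>N. (\<Sum>n<N. a n) / real N + (\<Sum>n<N. b n - a n) / real N) \<longlonglongrightarrow> l + 0"
    by (intro tendsto_add assms(2) cesaro_tendsto)
  then show ?thesis
    by (simp add: sum_subtractf diff_divide_distrib)
qed

lemma sum_square_eq:
  fixes a :: "nat \<Rightarrow> real"
  shows "(\<Sum>n<N. a n)\<^sup>2 = (\<Sum>n<N. (a n)\<^sup>2) + 2 * (\<Sum>n<N. \<Sum>i<n. a i * a n)"
proof (induction N)
  case (Suc N)
  have "(\<Sum>n<Suc N. a n)\<^sup>2 = (\<Sum>n<N. a n)\<^sup>2 + (a N)\<^sup>2 + 2 * (\<Sum>i<N. a i * a N)"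
    by (simp add: power2_sum sum_distrib_right)
  then show ?case
    using Suc by simp
qed simp

text \<open>Row n has n \<le> 2^n entries, so a tolerance of 4^-n per entry leaves 2^-n per row and
  a total independent of N. This is the origin of the tolerance 1/4 in the choice of almost
  orthogonal terms.\<close>

lemma sum_geometric_pairs_le:
  fixes c :: "nat \<Rightarrow> nat \<Rightarrow> real"
  assumes "\<And>i n. i < n \<Longrightarrow> c i n \<le> (1/4)^n"
  shows "(\<Sum>n<N. \<Sum>i<n. c i n) \<le> 2"
proof -
  have "(\<Sum>n<N. \<Sum>i<n. c i n) \<le> (\<Sum>n<N. (1/2)^n)"
  proof (rule sum_mono)
    fix n
    have "(\<Sum>i<n. c i n) \<le> (\<Sum>i<n. (1/4)^n)"
      by (rule sum_mono) (use assms in auto)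
    also have "\<dots> = real n * (1/4)^n" by simp
    also have "\<dots> \<le> 2^n * (1/4)^n"
      by (intro mult_right_mono) (auto intro: less_imp_le of_nat_less_two_power)
    also have "\<dots> = (1/2)^n" by (simp flip: power_mult_distrib)
    finally show "(\<Sum>i<n. c i n) \<le> (1/2)^n" .
  qed
  also have "\<dots> \<le> (\<Sum>n. (1/2)^n)" by (intro sum_le_suminf) auto
  also have "\<dots> = 2" by (simp add: suminf_geometric)
  finally show ?thesis .
qed

section \<open>Weak limits of bounded sequences\<close>

text \<open>The bound holds everywhere rather than almost everywhere, so that the class is closed
  under the algebraic operations without handling null sets, and integrability of any polynomial
  expression becomes a matter of introduction rules.\<close>

definition bdd_measurable :: "'a measure \<Rightarrow> ('a \<Rightarrow> real) \<Rightarrow> bool" where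
  "bdd_measurable M h \<longleftrightarrow> h \<in> borel_measurable M \<and> (\<exists>C. \<forall>x. \<bar>h x\<bar> \<le> C)"

lemma bdd_measurableI:
  "h \<in> borel_measurable M \<Longrightarrow> (\<And>x. \<bar>h x\<bar> \<le> C) \<Longrightarrow> bdd_measurable M h"
  unfolding bdd_measurable_def by auto

lemma bdd_measurable_borel:
  "bdd_measurable M h \<Longrightarrow> h \<in> borel_measurable M"
  unfolding bdd_measurable_def by auto

lemma bdd_measurableE:
  assumes "bdd_measurable M h"
  obtains C where "C > 0" "\<And>x. \<bar>h x\<bar> \<le> C"
proof -
  obtain C where "\<And>x. \<bar>h x\<bar> \<le> C" using assms unfolding bdd_measurable_def by auto
  then show ?thesis by (intro that[of "max C 1"]) (auto simp: le_max_iff_disj)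
qed

lemma bdd_measurable_const: "bdd_measurable M (\<lambda>x. c)"
  by (rule bdd_measurableI[of _ _ "\<bar>c\<bar>"]) auto

lemma bdd_measurable_indicator: "A \<in> sets M \<Longrightarrow> bdd_measurable M (indicator A)"
  by (rule bdd_measurableI[of _ _ 1]) (auto simp: indicator_def)

lemma bdd_measurable_add:
  assumes "bdd_measurable M g" "bdd_measurable M h"
  shows "bdd_measurable M (\<lambda>x. g x + h x)"
proof -
  from assms obtain C D where "\<And>x. \<bar>g x\<bar> \<le> C" "\<And>x. \<bar>h x\<bar> \<le> D"
    by (metis bdd_measurableE)
  then have "\<bar>g x + h x\<bar> \<le> C + D" for x
    by (meson abs_triangle_ineq add_mono order_trans)
  with assms[THEN bdd_measurable_borel] show ?thesis by (intro bdd_measurableI[of _ _ "C + D"]) auto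
qed

lemma bdd_measurable_mult:
  assumes "bdd_measurable M g" "bdd_measurable M h"
  shows "bdd_measurable M (\<lambda>x. g x * h x)"
proof -
  from assms obtain C D where "C > 0" "\<And>x. \<bar>g x\<bar> \<le> C" "\<And>x. \<bar>h x\<bar> \<le> D"
    by (metis bdd_measurableE)
  then have "\<bar>g x * h x\<bar> \<le> C * D" for x
    by (simp add: abs_mult mult_mono)
  with assms[THEN bdd_measurable_borel] show ?thesis by (intro bdd_measurableI[of _ _ "C * D"]) auto
qed

lemma bdd_measurable_diff:
  assumes "bdd_measurable M g" "bdd_measurable M h"
  shows "bdd_measurable M (\<lambda>x. g x - h x)"
  using bdd_measurable_add[OF assms(1) bdd_measurable_mult[OF bdd_measurable_const[of M "-1"] assms(2)]]
  by simp

lemma bdd_measurable_divide: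
  "bdd_measurable M g \<Longrightarrow> bdd_measurable M (\<lambda>x. g x / c)"
  using bdd_measurable_mult[OF _ bdd_measurable_const[of M "1 / c"]] by simp

lemma bdd_measurable_power2:
  "bdd_measurable M g \<Longrightarrow> bdd_measurable M (\<lambda>x. (g x)\<^sup>2)"
  unfolding power2_eq_square by (rule bdd_measurable_mult)

lemma bdd_measurable_sum:
  assumes "\<And>i. i \<in> I \<Longrightarrow> bdd_measurable M (h i)"
  shows "bdd_measurable M (\<lambda>x. \<Sum>i\<in>I. h i x)"
  using assms
  by (induction I rule: infinite_finite_induct)
     (auto intro: bdd_measurable_add bdd_measurable_const)

lemma bdd_measurable_prod:
  assumes "\<And>i. i \<in> I \<Longrightarrow> bdd_measurable M (h i)"
  shows "bdd_measurable M (\<lambda>x. \<Prod>i\<in>I. h i x)"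
  using assms
  by (induction I rule: infinite_finite_induct)
     (auto intro: bdd_measurable_mult bdd_measurable_const)

lemmas bdd_measurable_intros =
  bdd_measurable_const bdd_measurable_indicator bdd_measurable_add bdd_measurable_mult
  bdd_measurable_diff bdd_measurable_divide bdd_measurable_power2 bdd_measurable_sum
  bdd_measurable_prod

text \<open>For integrable functions this is weak convergence in L1. For uniformly bounded ones,
  members of the sequence and the limit itself are admissible test functions, which is what makes
  Hilbert space arguments available.\<close>

definition weakly_tendsto :: "'a measure \<Rightarrow> (nat \<Rightarrow> 'a \<Rightarrow> real) \<Rightarrow> ('a \<Rightarrow> real) \<Rightarrow> bool" where
  "weakly_tendsto M g \<phi> \<longleftrightarrow>
     (\<forall>h. bdd_measurable M h \<longrightarrow> (\<lambda>n. \<integral>x. g n x * h x \<partial>M) \<longlonglongrightarrow> (\<integral>x. \<phi> x * h x \<partial>M))"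

context prob_space
begin

lemma integrable_bdd: "bdd_measurable M h \<Longrightarrow> integrable M h"
  unfolding bdd_measurable_def by (elim conjE exE) (rule integrable_const_bound[OF AE_I2], auto)

lemma abs_expectation_le:
  assumes "bdd_measurable M h" "\<And>x. \<bar>h x\<bar> \<le> C"
  shows "\<bar>\<integral>x. h x \<partial>M\<bar> \<le> C"
proof -
  have "\<bar>\<integral>x. h x \<partial>M\<bar> \<le> (\<integral>x. \<bar>h x\<bar> \<partial>M)" by (rule integral_abs_bound)
  also have "\<dots> \<le> (\<integral>x. C \<partial>M)"
    by (intro integral_mono integrable_abs integrable_bdd bdd_measurable_const assms)
  finally show ?thesis by (simp add: prob_space)
qed

text \<open>Almost orthogonality in place of independence: the off-diagonal part is twice the bound
  2 of \<open>sum_geometric_pairs_le\<close>. Only an upper bound is sought, so a one-sided bound on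
  the cross terms suffices.\<close>

lemma expectation_sum_square_le:
  assumes Y: "\<And>n. bdd_measurable M (Y n)"
    and cross: "\<And>i n. i < n \<Longrightarrow> (\<integral>x. Y i x * Y n x \<partial>M) \<le> (1/4)^n"
  shows "(\<integral>x. (\<Sum>n<N. Y n x)\<^sup>2 \<partial>M) \<le> (\<Sum>n<N. \<integral>x. (Y n x)\<^sup>2 \<partial>M) + 4"
proof -
  have [simp]: "integrable M (\<lambda>x. (Y n x)\<^sup>2)" "integrable M (\<lambda>x. Y i x * Y n x)" for i n
    by (intro integrable_bdd bdd_measurable_intros Y)+
  have "(\<integral>x. (\<Sum>n<N. Y n x)\<^sup>2 \<partial>M)
      = (\<Sum>n<N. \<integral>x. (Y n x)\<^sup>2 \<partial>M) + 2 * (\<Sum>n<N. \<Sum>i<n. \<integral>x. Y i x * Y n x \<partial>M)"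
    by (simp add: sum_square_eq)
  also have "(\<Sum>n<N. \<Sum>i<n. \<integral>x. Y i x * Y n x \<partial>M) \<le> 2"
    by (intro sum_geometric_pairs_le cross)
  finally show ?thesis by simp
qed

text \<open>The sum of the squares has finite integral, so it is finite almost everywhere and its
  terms tend to 0.\<close>

lemma AE_tendsto_0_if_summable_second_moments:
  fixes Y :: "nat \<Rightarrow> 'a \<Rightarrow> real"
  assumes Y: "\<And>l. bdd_measurable M (Y l)"
    and sm: "summable (\<lambda>l. \<integral>x. (Y l x)\<^sup>2 \<partial>M)"
  shows "AE x in M. (\<lambda>l. Y l x) \<longlonglongrightarrow> 0"
proof -
  note [measurable] = bdd_measurable_borel[OF Y]
  have "(\<integral>\<^sup>+x. (\<Sum>l. ennreal ((Y l x)\<^sup>2)) \<partial>M) = (\<Sum>l. \<integral>\<^sup>+x. ennreal ((Y l x)\<^sup>2) \<partial>M)"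
    by (intro nn_integral_suminf) measurable
  also have "\<dots> = (\<Sum>l. ennreal (\<integral>x. (Y l x)\<^sup>2 \<partial>M))"
    by (intro suminf_cong nn_integral_eq_integral integrable_bdd bdd_measurable_intros Y) auto
  also have "\<dots> = ennreal (\<Sum>l. \<integral>x. (Y l x)\<^sup>2 \<partial>M)"
    by (intro suminf_ennreal2 sm) auto
  finally have "(\<integral>\<^sup>+x. (\<Sum>l. ennreal ((Y l x)\<^sup>2)) \<partial>M) \<noteq> \<infinity>"
    by simp
  then have "AE x in M. (\<Sum>l. ennreal ((Y l x)\<^sup>2)) \<noteq> \<infinity>"
    by (intro nn_integral_noteq_infinite) auto
  then show ?thesis
  proof eventually_elim
    case (elim x)
    then have "summable (\<lambda>l. (Y l x)\<^sup>2)"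
      by (intro summable_suminf_not_top) auto
    then have "(\<lambda>l. sqrt ((Y l x)\<^sup>2)) \<longlonglongrightarrow> sqrt 0"
      by (intro tendsto_real_sqrt summable_LIMSEQ_zero)
    then show ?case
      by (simp add: tendsto_rabs_zero_iff)
  qed
qed

text \<open>The averages over \<open>4\<^sup>k\<close> terms of a subsequence whose Gram matrix is almost constant off the
  diagonal converge in mean square, at a geometric rate.\<close>

lemma weak_cluster_point:
  fixes g :: "nat \<Rightarrow> 'a \<Rightarrow> real"
  assumes g: "\<And>n. g n \<in> borel_measurable M" and gC: "\<And>n x. \<bar>g n x\<bar> \<le> C"
    and lim1: "\<And>m. (\<lambda>n. \<integral>x. g n x * g m x \<partial>M) \<longlonglongrightarrow> b m" and lim2: "b \<longlonglongrightarrow> b'"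
  obtains r :: "nat \<Rightarrow> nat" and \<phi> where "strict_mono r" "\<phi> \<in> borel_measurable M" "\<And>x. \<bar>\<phi> x\<bar> \<le> C"
    "AE x in M. (\<lambda>k. (\<Sum>n<4^k. g (r n) x) / 4^k) \<longlonglongrightarrow> \<phi> x"
proof -
  have bdd: "bdd_measurable M (g n)" for n
    by (rule bdd_measurableI[OF g gC])
  have "C \<ge> 0" using gC[of 0 undefined] by linarith
  \<comment> \<open>The Gram entry with an earlier term has to be near the limit of that row, and
    the row limit of the new term near \<open>b'\<close>. For i < n the entry (i, n) then differs
    from \<open>b'\<close> by at most 2^-n + 2^-i.\<close>
  define P where "P t \<rho> m \<longleftrightarrow> (\<forall>i\<in>{..<t}. \<bar>(\<integral>x. g m x * g (\<rho> i) x \<partial>M) - b (\<rho> i)\<bar> < (1/2)^t)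
      \<and> \<bar>b m - b'\<bar> < (1/2)^t" for t \<rho> m
  obtain r where r: "strict_mono r" "\<And>t. P t r (r t)"
  proof (rule strict_mono_select[of P])
    show "P t \<rho> m \<longleftrightarrow> P t \<rho>' m" if "\<And>i. i < t \<Longrightarrow> \<rho> i = \<rho>' i" for t \<rho> \<rho>' m
      using that unfolding P_def by auto
  next
    fix t :: nat and \<rho> :: "nat \<Rightarrow> nat"
    have pos: "(1/2)^t > (0::real)" by simp
    have "\<forall>\<^sub>F m in sequentially. \<forall>i\<in>{..<t}. \<bar>(\<integral>x. g m x * g (\<rho> i) x \<partial>M) - b (\<rho> i)\<bar> < (1/2)^t"
      using tendstoD[OF lim1 pos] by (intro eventually_ball_finite) (auto simp: dist_real_def)
    moreover have "\<forall>\<^sub>F m in sequentially. \<bar>b m - b'\<bar> < (1/2)^t"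
      using tendstoD[OF lim2 pos] by (auto simp: dist_real_def)
    ultimately show "eventually (P t \<rho>) sequentially"
      unfolding P_def by eventually_elim auto
  qed auto
  define d where "d i n = (\<integral>x. g (r i) x * g (r n) x \<partial>M) - b'" for i n
  have d_sym: "d i n = d n i" for i n
    by (simp add: d_def mult.commute)
  have d_off: "\<bar>d i n\<bar> \<le> 2 * (1/2)^i" if "i < n" for i n
  proof -
    have "\<bar>(\<integral>x. g (r n) x * g (r i) x \<partial>M) - b (r i)\<bar> < (1/2)^n" "\<bar>b (r i) - b'\<bar> < (1/2)^i"
      using r(2)[of n] r(2)[of i] that unfolding P_def by auto
    moreover have "(1/2)^n \<le> (1/2 :: real)^i"
      using that by (intro power_decreasing) auto
    moreover have "d i n = (\<integral>x. g (r n) x * g (r i) x \<partial>M) - b'"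
      by (simp add: d_def mult.commute)
    ultimately show ?thesis by linarith
  qed
  have E_bd: "\<bar>\<integral>x. g i x * g n x \<partial>M\<bar> \<le> C\<^sup>2" for i n
    using \<open>C \<ge> 0\<close>
    by (intro abs_expectation_le bdd_measurable_intros bdd)
       (auto simp: abs_mult power2_eq_square intro!: mult_mono gC)
  have b_bd: "\<bar>b m\<bar> \<le> C\<^sup>2" for m
    using tendsto_rabs[OF lim1[of m]] by (rule LIMSEQ_le_const2) (use E_bd in auto)
  have b'_bd: "\<bar>b'\<bar> \<le> C\<^sup>2"
    using tendsto_rabs[OF lim2] by (rule LIMSEQ_le_const2) (use b_bd in auto)
  \<comment> \<open>A new index adds a diagonal entry of size at most 2 C^2 and a row and a column
    of total at most 4 each.\<close>
  define K where "K = 2 * C\<^sup>2 + 8"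
  have "K > 0" by (simp add: K_def add_nonneg_pos)
  have d_sum: "(\<Sum>i<N. \<Sum>n<N. \<bar>d i n\<bar>) \<le> K * real N" for N
  proof (induction N)
    case (Suc N)
    have geo: "(\<Sum>i<N. \<bar>d i N\<bar>) \<le> 4"
    proof -
      have "(\<Sum>i<N. \<bar>d i N\<bar>) \<le> (\<Sum>i<N. 2 * (1/2)^i)"
        by (rule sum_mono) (use d_off in auto)
      also have "\<dots> \<le> (\<Sum>i. 2 * (1/2)^i)"
        by (intro sum_le_suminf summable_mult) auto
      also have "\<dots> = 4" by (simp add: suminf_mult suminf_geometric)
      finally show ?thesis .
    qed
    have "\<bar>d N N\<bar> \<le> 2 * C\<^sup>2"
      using E_bd[of "r N" "r N"] b'_bd unfolding d_def by linarith
    have "(\<Sum>i<Suc N. \<Sum>n<Suc N. \<bar>d i n\<bar>)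
        = (\<Sum>i<N. \<Sum>n<N. \<bar>d i n\<bar>) + (\<Sum>i<N. \<bar>d i N\<bar>) + (\<Sum>i<N. \<bar>d N i\<bar>) + \<bar>d N N\<bar>"
      by (simp add: sum.distrib)
    also have "(\<Sum>i<N. \<bar>d N i\<bar>) = (\<Sum>i<N. \<bar>d i N\<bar>)"
      by (simp add: d_sym)
    finally show ?case
      using Suc geo \<open>\<bar>d N N\<bar> \<le> _\<close> by (simp add: K_def algebra_simps)
  qed simp
  define S where "S k x = (\<Sum>n<4^k. g (r n) x) / 4^k" for k x
  have bdd_S: "bdd_measurable M (S k)" for k
    unfolding S_def by (intro bdd_measurable_intros bdd)
  note [measurable] = g bdd_measurable_borel[OF bdd_S]
  have S_L2: "(\<integral>x. (S (Suc k) x - S k x)\<^sup>2 \<partial>M) \<le> 4 * K * (1/4)^k" for k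
  proof -
    define N :: nat where "N = 4^Suc k"
    \<comment> \<open>The difference of consecutive averages as one linear combination. Its weights
      sum to 0, which cancels the constant \<open>b'\<close> in the Gram matrix, and each is at most
      4^-k; the remainder is at most 16^-k times the bound \<open>K * 4^(k+1)\<close> from
      \<open>d_sum\<close>.\<close>
    define wt :: "nat \<Rightarrow> real" where "wt n = 1 / 4^Suc k - (if n < 4^k then 1 / 4^k else 0)" for n
    have wt_le: "\<bar>wt n\<bar> \<le> (1/4)^k" for n
      by (auto simp: wt_def field_simps)
    have restrict: "(\<Sum>n<N. if n < 4^k then h n else 0) = (\<Sum>n<4^k. h n)" for h :: "nat \<Rightarrow> real"
    proof -
      have "(\<Sum>n<N. if n < 4^k then h n else 0) = (\<Sum>n\<in>{..<N} \<inter> {n. n < 4^k}. h n)"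
        by (simp add: sum.inter_restrict)
      moreover have "{..<N} \<inter> {n. n < 4^k} = {..<4^k}"
        by (auto simp: N_def)
      ultimately show ?thesis by simp
    qed
    have "(\<Sum>n<N. wt n) = real N / 4^Suc k - (\<Sum>n<N. if n < 4^k then 1 / 4^k else 0)"
      by (simp add: wt_def sum_subtractf)
    then have wt_sum: "(\<Sum>n<N. wt n) = 0"
      by (subst (asm) restrict) (simp add: N_def)
    have S_eq: "S (Suc k) x - S k x = (\<Sum>n<N. wt n * g (r n) x)" for x
    proof -
      have "(\<Sum>n<N. wt n * g (r n) x)
          = (\<Sum>n<N. g (r n) x) / 4^Suc k - (\<Sum>n<N. if n < 4^k then g (r n) x / 4^k else 0)"
        unfolding sum_divide_distrib sum_subtractf[symmetric]
        by (rule sum.cong) (auto simp: wt_def field_simps)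
      then show ?thesis
        by (subst (asm) restrict) (simp add: S_def N_def sum_divide_distrib)
    qed
    have "(\<integral>x. (S (Suc k) x - S k x)\<^sup>2 \<partial>M)
        = (\<integral>x. (\<Sum>i<N. \<Sum>n<N. wt i * wt n * (g (r i) x * g (r n) x)) \<partial>M)"
      by (simp add: S_eq power2_eq_square sum_product mult_ac)
    also have "\<dots> = (\<Sum>i<N. \<Sum>n<N. wt i * wt n * (\<integral>x. g (r i) x * g (r n) x \<partial>M))"
    proof -
      have "integrable M (\<lambda>x. g (r i) x * g (r n) x)" for i n
        by (intro integrable_bdd bdd_measurable_intros bdd)
      then show ?thesis by simp
    qed
    also have "\<dots> = (\<Sum>i<N. \<Sum>n<N. wt i * wt n * d i n) + (\<Sum>i<N. \<Sum>n<N. wt i * wt n) * b'"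
      by (simp add: d_def sum_distrib_right right_diff_distrib flip: sum.distrib)
    also have "(\<Sum>i<N. \<Sum>n<N. wt i * wt n) = 0"
      by (simp add: sum_distrib_left[symmetric] wt_sum)
    also have "(\<Sum>i<N. \<Sum>n<N. wt i * wt n * d i n) \<le> (\<Sum>i<N. \<Sum>n<N. (1/4)^k * (1/4)^k * \<bar>d i n\<bar>)"
    proof (intro sum_mono)
      fix i n
      have "wt i * wt n * d i n \<le> \<bar>wt i\<bar> * \<bar>wt n\<bar> * \<bar>d i n\<bar>"
        by (metis abs_ge_self abs_mult)
      also have "\<dots> \<le> (1/4)^k * (1/4)^k * \<bar>d i n\<bar>"
        by (intro mult_mono wt_le) auto
      finally show "wt i * wt n * d i n \<le> (1/4)^k * (1/4)^k * \<bar>d i n\<bar>" .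
    qed
    also have "\<dots> = (1/4)^k * (1/4)^k * (\<Sum>i<N. \<Sum>n<N. \<bar>d i n\<bar>)"
      by (simp add: sum_distrib_left)
    also have "\<dots> \<le> (1/4)^k * (1/4)^k * (K * real N)"
      by (intro mult_left_mono d_sum) auto
    also have "\<dots> = 4 * K * (1/4)^k"
      by (simp add: N_def power_divide)
    finally show ?thesis by simp
  qed
  \<comment> \<open>The second moments decay like 4^-k. Spending half of this decay on the factor
    \<open>sqrt 2 ^ k\<close> keeps them summable and gives the pointwise bound (1 / sqrt 2)^k on
    the increments.\<close>
  have "summable (\<lambda>k. \<integral>x. (sqrt 2 ^ k * (S (Suc k) x - S k x))\<^sup>2 \<partial>M)"
  proof (rule summable_comparison_test)
    show "summable (\<lambda>k. 4 * K * (1/2)^k)" by (intro summable_mult) auto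
    have "(\<integral>x. (sqrt 2 ^ k * (S (Suc k) x - S k x))\<^sup>2 \<partial>M) \<le> 4 * K * (1/2)^k" for k
    proof -
      have "(sqrt 2 ^ k)\<^sup>2 = 2^k"
        by (simp add: power_mult[symmetric] mult.commute[of k] power_mult)
      then have "(\<integral>x. (sqrt 2 ^ k * (S (Suc k) x - S k x))\<^sup>2 \<partial>M)
          = 2^k * (\<integral>x. (S (Suc k) x - S k x)\<^sup>2 \<partial>M)"
        by (simp add: power_mult_distrib)
      also have "\<dots> \<le> 2^k * (4 * K * (1/4)^k)"
        by (intro mult_left_mono S_L2) auto
      also have "\<dots> = 4 * K * (1/2)^k"
        by (simp add: power_divide field_simps flip: power_mult_distrib)
      finally show ?thesis .
    qed
    then show "\<exists>n0. \<forall>k\<ge>n0. norm (\<integral>x. (sqrt 2 ^ k * (S (Suc k) x - S k x))\<^sup>2 \<partial>M) \<le> 4 * K * (1/2)^k"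
      by (auto intro!: exI[of _ 0])
  qed
  then have "AE x in M. (\<lambda>k. sqrt 2 ^ k * (S (Suc k) x - S k x)) \<longlonglongrightarrow> 0"
    by (intro AE_tendsto_0_if_summable_second_moments bdd_measurable_intros bdd_S)
  then have AE_conv: "AE x in M. convergent (\<lambda>k. S k x)"
  proof eventually_elim
    case (elim x)
    then have "eventually (\<lambda>k. \<bar>sqrt 2 ^ k * (S (Suc k) x - S k x)\<bar> < 1) sequentially"
      using tendstoD[OF elim, of 1] by (simp add: dist_real_def)
    then have "eventually (\<lambda>k. norm (S (Suc k) x - S k x) \<le> (1 / sqrt 2)^k) sequentially"
    proof eventually_elim
      case (elim k)
      then show ?case
        unfolding abs_mult by (simp add: power_divide pos_le_divide_eq mult.commute)
    qed
    then have "summable (\<lambda>k. S (Suc k) x - S k x)"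
      by (rule summable_comparison_test_ev) (auto intro!: summable_geometric)
    then have "convergent (\<lambda>k. \<Sum>i<k. S (Suc i) x - S i x)"
      by (simp add: summable_iff_convergent)
    then have "convergent (\<lambda>k. S k x - S 0 x)"
      using sum_lessThan_telescope[of "\<lambda>k. S k x"] by simp
    then show ?case
      by (simp add: convergent_diff_const_right_iff)
  qed
  \<comment> \<open>Clamping gives the bound C also at points without a limit; where the averages
    converge, their limit already lies in [-C, C].\<close>
  define \<phi> where "\<phi> x = max (- C) (min C (lim (\<lambda>k. S k x)))" for x
  show ?thesis
  proof
    show "strict_mono r" by fact
    show "\<phi> \<in> borel_measurable M" unfolding \<phi>_def by measurable
    show "\<bar>\<phi> x\<bar> \<le> C" for x using \<open>C \<ge> 0\<close> unfolding \<phi>_def by (auto simp: abs_le_iff)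
    show "AE x in M. (\<lambda>k. (\<Sum>n<4^k. g (r n) x) / 4^k) \<longlonglongrightarrow> \<phi> x"
      using AE_conv
    proof eventually_elim
      case (elim x)
      then have l: "(\<lambda>k. S k x) \<longlonglongrightarrow> lim (\<lambda>k. S k x)"
        by (simp add: convergent_LIMSEQ_iff)
      have "\<bar>S k x\<bar> \<le> C" for k
      proof -
        have "\<bar>\<Sum>n<4^k. g (r n) x\<bar> \<le> (\<Sum>n<(4::nat)^k. C)"
          by (rule order_trans[OF sum_abs sum_mono]) (rule gC)
        then show ?thesis by (simp add: S_def field_simps)
      qed
      then have "- C \<le> lim (\<lambda>k. S k x)" "lim (\<lambda>k. S k x) \<le> C"
        by (intro LIMSEQ_le_const[OF l] LIMSEQ_le_const2[OF l]; auto simp: abs_le_iff minus_le_iff)+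
      then show ?case
        using l by (simp add: \<phi>_def S_def max_def min_def)
    qed
  qed
qed

text \<open>If the integrals against h converge at all, so do their averages, with the same limit,
  and dominated convergence evaluates the latter by \<phi>. The hypothesis that they converge is
  removed in the next lemma.\<close>

lemma integral_cluster_point:
  fixes g :: "nat \<Rightarrow> 'a \<Rightarrow> real"
  assumes g: "\<And>n. g n \<in> borel_measurable M" and gC: "\<And>n x. \<bar>g n x\<bar> \<le> C"
    and \<phi> [measurable]: "\<phi> \<in> borel_measurable M"
    and ae: "AE x in M. (\<lambda>k. (\<Sum>n<4^k. g n x) / 4^k) \<longlonglongrightarrow> \<phi> x"
    and h: "bdd_measurable M h"
    and lim: "(\<lambda>n. \<integral>x. g n x * h x \<partial>M) \<longlonglongrightarrow> c"
  shows "(\<integral>x. \<phi> x * h x \<partial>M) = c"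
proof -
  note [measurable] = g bdd_measurable_borel[OF h]
  have bdd: "bdd_measurable M (g n)" for n
    by (rule bdd_measurableI[OF g gC])
  obtain D where D: "D > 0" "\<And>x. \<bar>h x\<bar> \<le> D" using h by (rule bdd_measurableE) blast
  have "C \<ge> 0" using gC[of 0 undefined] by linarith
  have "(\<lambda>k. \<integral>x. (\<Sum>n<4^k. g n x) / 4^k * h x \<partial>M) \<longlonglongrightarrow> (\<integral>x. \<phi> x * h x \<partial>M)"
  proof (rule integral_dominated_convergence[where w = "\<lambda>_. C * D"])
    show "AE x in M. (\<lambda>k. (\<Sum>n<4^k. g n x) / 4^k * h x) \<longlonglongrightarrow> \<phi> x * h x"
      using ae by eventually_elim (intro tendsto_intros)
    show "AE x in M. norm ((\<Sum>n<4^k. g n x) / 4^k * h x) \<le> C * D" for k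
    proof (rule AE_I2)
      fix x
      have "\<bar>\<Sum>n<4^k. g n x\<bar> \<le> (\<Sum>n<(4::nat)^k. C)"
        by (rule order_trans[OF sum_abs sum_mono]) (rule gC)
      then have "\<bar>(\<Sum>n<4^k. g n x) / 4^k\<bar> \<le> C" by (simp add: field_simps)
      then show "norm ((\<Sum>n<4^k. g n x) / 4^k * h x) \<le> C * D"
        unfolding real_norm_def abs_mult using D \<open>C \<ge> 0\<close> by (intro mult_mono) auto
    qed
  qed auto
  moreover have "(\<integral>x. (\<Sum>n<4^k. g n x) / 4^k * h x \<partial>M) = (\<Sum>n<4^k. \<integral>x. g n x * h x \<partial>M) / real (4^k)" for k
  proof -
    have "integrable M (\<lambda>x. g n x * h x)" for n
      by (intro integrable_bdd bdd_measurable_intros bdd h)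
    then show ?thesis
      by (simp add: sum_distrib_right)
  qed
  moreover have "(\<lambda>k. (\<Sum>n<4^k. \<integral>x. g n x * h x \<partial>M) / real (4^k)) \<longlonglongrightarrow> c"
    using LIMSEQ_subseq_LIMSEQ[OF cesaro_tendsto[OF lim], of "\<lambda>k. 4^k"]
    by (simp add: o_def strict_mono_def power_strict_increasing)
  ultimately show ?thesis
    using LIMSEQ_unique by simp
qed

text \<open>A cluster point is known to give the right value only for those h against which the
  integrals converge. If another value occurred for some h, a subsequence would have a cluster point
  \<psi> realising it. The Gram limits force E \<phi>^2, E \<phi>\<psi> and E \<psi>^2 all to equal
  \<open>b'\<close>, hence E (\<psi> - \<phi>)^2 = 0 and the two values agree.\<close>

lemma weakly_tendsto_of_gram_limits:
  fixes g :: "nat \<Rightarrow> 'a \<Rightarrow> real"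
  assumes g: "\<And>n. g n \<in> borel_measurable M" and gC: "\<And>n x. \<bar>g n x\<bar> \<le> C"
    and lim1: "\<And>m. (\<lambda>n. \<integral>x. g n x * g m x \<partial>M) \<longlonglongrightarrow> b m" and lim2: "b \<longlonglongrightarrow> b'"
  obtains \<phi> where "\<phi> \<in> borel_measurable M" "\<And>x. \<bar>\<phi> x\<bar> \<le> C" "weakly_tendsto M g \<phi>"
proof -
  have bdd: "bdd_measurable M (g n)" for n
    by (rule bdd_measurableI[OF g gC])
  have cluster: "\<exists>(r::nat\<Rightarrow>nat) \<psi>. strict_mono r \<and> \<psi> \<in> borel_measurable M \<and> (\<forall>x. \<bar>\<psi> x\<bar> \<le> C) \<and>
      (\<forall>h c. bdd_measurable M h \<and> (\<lambda>n. \<integral>x. g (s n) x * h x \<partial>M) \<longlonglongrightarrow> c \<longrightarrow> (\<integral>x. \<psi> x * h x \<partial>M) = c)"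
    if s: "strict_mono s" for s :: "nat \<Rightarrow> nat"
  proof -
    obtain r :: "nat \<Rightarrow> nat" and \<psi> where r: "strict_mono r" "\<psi> \<in> borel_measurable M" "\<And>x. \<bar>\<psi> x\<bar> \<le> C"
      "AE x in M. (\<lambda>k. (\<Sum>n<4^k. g (s (r n)) x) / 4^k) \<longlonglongrightarrow> \<psi> x"
      by (rule weak_cluster_point[of "\<lambda>n. g (s n)" C "\<lambda>n. b (s n)" b'])
         (use g gC lim1[THEN LIMSEQ_subseq_LIMSEQ, OF s] lim2[THEN LIMSEQ_subseq_LIMSEQ, OF s] in \<open>auto simp: o_def\<close>)
    have "(\<integral>x. \<psi> x * h x \<partial>M) = c"
      if "bdd_measurable M h" "(\<lambda>n. \<integral>x. g (s n) x * h x \<partial>M) \<longlonglongrightarrow> c" for h c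
      by (rule integral_cluster_point[OF g gC r(2) r(4) that(1)])
         (use LIMSEQ_subseq_LIMSEQ[OF that(2) \<open>strict_mono r\<close>] in \<open>simp add: o_def\<close>)
    with r show ?thesis by blast
  qed
  obtain \<phi> where \<phi>: "\<phi> \<in> borel_measurable M" "\<And>x. \<bar>\<phi> x\<bar> \<le> C"
    and \<phi>_lim: "\<And>h c. bdd_measurable M h \<Longrightarrow> (\<lambda>n. \<integral>x. g n x * h x \<partial>M) \<longlonglongrightarrow> c \<Longrightarrow> (\<integral>x. \<phi> x * h x \<partial>M) = c"
    using cluster[of "\<lambda>n. n"] by (auto simp: strict_mono_def)
  have bdd_\<phi>: "bdd_measurable M \<phi>" by (rule bdd_measurableI[OF \<phi>])
  have g\<phi>: "(\<lambda>m. \<integral>x. g m x * \<phi> x \<partial>M) \<longlonglongrightarrow> b'"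
    using lim2 \<phi>_lim[OF bdd lim1] by (simp add: mult.commute)
  have "weakly_tendsto M g \<phi>"
    unfolding weakly_tendsto_def
  proof (intro allI impI, rule ccontr)
    fix h assume h: "bdd_measurable M h"
    let ?u = "\<lambda>n. \<integral>x. g n x * h x \<partial>M" and ?l = "\<integral>x. \<phi> x * h x \<partial>M"
    assume "\<not> ?u \<longlonglongrightarrow> ?l"
    then obtain e where e: "e > 0" "\<And>n0. \<exists>n\<ge>n0. \<bar>?u n - ?l\<bar> \<ge> e"
      unfolding LIMSEQ_def dist_real_def by (metis not_le)
    then have inf: "infinite {n. \<bar>?u n - ?l\<bar> \<ge> e}"
      unfolding infinite_nat_iff_unbounded_le by auto
    define s1 where "s1 = enumerate {n. \<bar>?u n - ?l\<bar> \<ge> e}"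
    have s1: "strict_mono s1" "\<And>n. \<bar>?u (s1 n) - ?l\<bar> \<ge> e"
      using enumerate_in_set[OF inf] strict_mono_enumerate[OF inf] unfolding s1_def by auto
    obtain D where D: "D > 0" "\<And>x. \<bar>h x\<bar> \<le> D" using h by (rule bdd_measurableE) blast
    have "C \<ge> 0" using gC[of 0 undefined] by linarith
    have "\<bar>?u n\<bar> \<le> C * D" for n
      using D \<open>C \<ge> 0\<close>
      by (intro abs_expectation_le bdd_measurable_intros bdd h)
         (auto simp: abs_mult intro!: mult_mono gC)
    then have "bounded (range (\<lambda>n. ?u (s1 n)))"
      by (intro boundedI[of _ "C * D"]) auto
    then obtain c and s2 :: "nat \<Rightarrow> nat" where s2: "strict_mono s2" "(\<lambda>n. ?u (s1 (s2 n))) \<longlonglongrightarrow> c"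
      using bounded_imp_convergent_subsequence[of "\<lambda>n. ?u (s1 n)"] by (auto simp: o_def)
    define s where "s = s1 \<circ> s2"
    have s: "strict_mono s" unfolding s_def using s1(1) s2(1) by (rule strict_mono_o)
    obtain \<psi> where \<psi>: "\<psi> \<in> borel_measurable M" "\<And>x. \<bar>\<psi> x\<bar> \<le> C"
      and \<psi>_lim: "\<And>h c. bdd_measurable M h \<Longrightarrow> (\<lambda>n. \<integral>x. g (s n) x * h x \<partial>M) \<longlonglongrightarrow> c
        \<Longrightarrow> (\<integral>x. \<psi> x * h x \<partial>M) = c"
      using cluster[OF s] by blast
    have bdd_\<psi>: "bdd_measurable M \<psi>" by (rule bdd_measurableI[OF \<psi>])
    have "(\<integral>x. \<psi> x * g m x \<partial>M) = b m" for m
      using \<psi>_lim[OF bdd] lim1[THEN LIMSEQ_subseq_LIMSEQ, OF s] by (simp add: o_def)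
    then have "(\<lambda>m. \<integral>x. g m x * \<psi> x \<partial>M) \<longlonglongrightarrow> b'"
      using lim2 by (simp add: mult.commute)
    then have "(\<integral>x. \<psi> x * \<psi> x \<partial>M) = b'"
      using \<psi>_lim[OF bdd_\<psi>] LIMSEQ_subseq_LIMSEQ[OF _ s] by (fastforce simp: o_def)
    moreover have "(\<integral>x. \<psi> x * \<phi> x \<partial>M) = b'"
      using \<psi>_lim[OF bdd_\<phi>] LIMSEQ_subseq_LIMSEQ[OF g\<phi> s] by (simp add: o_def)
    moreover have "(\<integral>x. \<phi> x * \<phi> x \<partial>M) = b'"
      using \<phi>_lim[OF bdd_\<phi> g\<phi>] .
    moreover have "(\<integral>x. (\<psi> x - \<phi> x)\<^sup>2 \<partial>M)
        = (\<integral>x. \<psi> x * \<psi> x - 2 * (\<psi> x * \<phi> x) + \<phi> x * \<phi> x \<partial>M)"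
      by (intro Bochner_Integration.integral_cong) (auto simp: power2_eq_square algebra_simps)
    moreover have "integrable M (\<lambda>x. \<psi> x * \<psi> x)" "integrable M (\<lambda>x. \<psi> x * \<phi> x)" "integrable M (\<lambda>x. \<phi> x * \<phi> x)"
      by (intro integrable_bdd bdd_measurable_intros bdd_\<psi> bdd_\<phi>)+
    ultimately have "(\<integral>x. (\<psi> x - \<phi> x)\<^sup>2 \<partial>M) = 0"
      by simp
    moreover have "integrable M (\<lambda>x. (\<psi> x - \<phi> x)\<^sup>2)"
      by (intro integrable_bdd bdd_measurable_intros bdd_\<psi> bdd_\<phi>)
    ultimately have "AE x in M. (\<psi> x - \<phi> x)\<^sup>2 = 0"
      by (subst (asm) integral_nonneg_eq_0_iff_AE) auto
    then have "(\<integral>x. \<psi> x * h x \<partial>M) = ?l"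
      by (intro integral_cong_AE) (use \<psi> \<phi> bdd_measurable_borel[OF h] in auto)
    moreover have "(\<integral>x. \<psi> x * h x \<partial>M) = c"
      using \<psi>_lim[OF h] s2(2) by (simp add: s_def)
    moreover have "e \<le> \<bar>c - ?l\<bar>"
      using tendsto_rabs[OF tendsto_diff[OF s2(2) tendsto_const]]
      by (rule LIMSEQ_le_const) (use s1(2) in auto)
    ultimately show False using e(1) by simp
  qed
  with \<phi> that show ?thesis by blast
qed

text \<open>Two diagonal choices supply the Gram hypotheses for all i at once: one for the products
  with each fixed term, one for the limits of these products.\<close>

lemma weakly_convergent_array:
  fixes G :: "nat \<Rightarrow> nat \<Rightarrow> 'a \<Rightarrow> real"
  assumes G: "\<And>i m. G i m \<in> borel_measurable M" and GC: "\<And>i m x. \<bar>G i m x\<bar> \<le> C i"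
  obtains r :: "nat \<Rightarrow> nat" and \<phi> where "strict_mono r"
    "\<And>i. \<phi> i \<in> borel_measurable M" "\<And>i x. \<bar>\<phi> i x\<bar> \<le> C i"
    "\<And>i. weakly_tendsto M (\<lambda>n. G i (r n)) (\<phi> i)"
proof -
  have bdd: "bdd_measurable M (G i m)" for i m
    by (rule bdd_measurableI[OF G GC])
  have "C i \<ge> 0" for i using GC[of i 0 undefined] by linarith
  then have E_bd: "\<bar>\<integral>x. G i n x * G i m x \<partial>M\<bar> \<le> C i * C i" for i n m
    by (intro abs_expectation_le bdd_measurable_intros bdd)
       (auto simp: abs_mult intro!: mult_mono GC)
  \<comment> \<open>One scalar sequence for each pair of a row and a fixed partner. The partner runs
    over all original indices because \<open>r1\<close> is not yet known; afterwards only partners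
    \<open>r1 m\<close> are used.\<close>
  define c where "c j n = (\<integral>x. G (fst (prod_decode j)) n x * G (fst (prod_decode j)) (snd (prod_decode j)) x \<partial>M)"
    for j n
  have "Bseq (c j)" for j
    unfolding c_def by (rule BseqI') (use E_bd in auto)
  then obtain r1 where r1: "strict_mono r1" "\<And>j. convergent (\<lambda>n. c j (r1 n))"
    by (rule diagonal_convergent_subseq[of c]) blast
  define b where "b i m = lim (\<lambda>n. \<integral>x. G i (r1 n) x * G i (r1 m) x \<partial>M)" for i m
  have b: "(\<lambda>n. \<integral>x. G i (r1 n) x * G i (r1 m) x \<partial>M) \<longlonglongrightarrow> b i m" for i m
    using r1(2)[of "prod_encode (i, r1 m)"] unfolding c_def b_def by (simp add: convergent_LIMSEQ_iff)
  have "\<bar>b i m\<bar> \<le> C i * C i" for i m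
    using tendsto_rabs[OF b[of i m]] by (rule LIMSEQ_le_const2) (use E_bd in auto)
  then have "Bseq (b i)" for i
    by (intro BseqI') auto
  then obtain r2 where r2: "strict_mono r2" "\<And>i. convergent (\<lambda>n. b i (r2 n))"
    by (rule diagonal_convergent_subseq[of b]) blast
  define r where "r = r1 \<circ> r2"
  have "\<exists>\<phi>. \<phi> \<in> borel_measurable M \<and> (\<forall>x. \<bar>\<phi> x\<bar> \<le> C i) \<and> weakly_tendsto M (\<lambda>n. G i (r n)) \<phi>" for i
  proof -
    obtain b' where "(\<lambda>n. b i (r2 n)) \<longlonglongrightarrow> b'"
      using r2(2) by (auto simp: convergent_def)
    moreover have "(\<lambda>n. \<integral>x. G i (r n) x * G i (r m) x \<partial>M) \<longlonglongrightarrow> b i (r2 m)" for m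
      using LIMSEQ_subseq_LIMSEQ[OF b r2(1), of i "r2 m"] by (simp add: r_def o_def)
    ultimately show ?thesis
      using weakly_tendsto_of_gram_limits[of "\<lambda>n. G i (r n)" "C i" "\<lambda>n. b i (r2 n)" b'] G GC
      by (metis (no_types, lifting))
  qed
  then obtain \<phi> where "\<And>i. \<phi> i \<in> borel_measurable M \<and> (\<forall>x. \<bar>\<phi> i x\<bar> \<le> C i) \<and>
      weakly_tendsto M (\<lambda>n. G i (r n)) (\<phi> i)"
    by metis
  then show ?thesis
    using that[of r \<phi>] strict_mono_o[OF r1(1) r2(1)] unfolding r_def by blast
qed

text \<open>Testing against the indicator of the set where the conclusion fails gives a nonnegative
  integrand whose integral is at most 0.\<close>

lemma weakly_tendsto_mono:
  assumes g: "weakly_tendsto M g \<phi>" "weakly_tendsto M g' \<psi>"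
    and bdd: "\<And>n. bdd_measurable M (g n)" "\<And>n. bdd_measurable M (g' n)"
      "bdd_measurable M \<phi>" "bdd_measurable M \<psi>"
    and le: "\<And>n x. g n x \<le> g' n x"
  shows "AE x in M. \<phi> x \<le> \<psi> x"
proof -
  note [measurable] = bdd[THEN bdd_measurable_borel]
  define A where "A = {x \<in> space M. \<psi> x < \<phi> x}"
  have A [measurable]: "A \<in> sets M" unfolding A_def by measurable
  have i: "integrable M (\<lambda>x. h x * indicator A x)" if "bdd_measurable M h" for h :: "'a \<Rightarrow> real"
    by (intro integrable_bdd bdd_measurable_intros A that)
  have "(\<integral>x. \<phi> x * indicator A x \<partial>M) \<le> (\<integral>x. \<psi> x * indicator A x \<partial>M)"
  proof (rule LIMSEQ_le)
    show "(\<lambda>n. \<integral>x. g n x * indicator A x \<partial>M) \<longlonglongrightarrow> (\<integral>x. \<phi> x * indicator A x \<partial>M)"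
      "(\<lambda>n. \<integral>x. g' n x * indicator A x \<partial>M) \<longlonglongrightarrow> (\<integral>x. \<psi> x * indicator A x \<partial>M)"
      using g bdd_measurable_indicator[OF A] unfolding weakly_tendsto_def by auto
    show "\<exists>N. \<forall>n\<ge>N. (\<integral>x. g n x * indicator A x \<partial>M) \<le> (\<integral>x. g' n x * indicator A x \<partial>M)"
      by (intro exI[of _ 0] allI impI integral_mono i bdd mult_right_mono le) auto
  qed
  then have "(\<integral>x. (\<phi> x - \<psi> x) * indicator A x \<partial>M) \<le> 0"
    by (simp add: left_diff_distrib i bdd)
  moreover have nn: "(\<phi> x - \<psi> x) * indicator A x \<ge> 0" for x
    by (auto simp: A_def indicator_def)
  ultimately have "(\<integral>x. (\<phi> x - \<psi> x) * indicator A x \<partial>M) = 0"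
    by (intro antisym Bochner_Integration.integral_nonneg) auto
  then have "AE x in M. (\<phi> x - \<psi> x) * indicator A x = 0"
    using nn by (subst (asm) integral_nonneg_eq_0_iff_AE) (auto intro!: i bdd bdd_measurable_intros)
  then show ?thesis
    using AE_space by eventually_elim (force simp: A_def indicator_def split: if_splits)
qed

end

lemma weakly_tendsto_subseq:
  assumes "weakly_tendsto M g \<phi>" "strict_mono r"
  shows "weakly_tendsto M (\<lambda>n. g (r n)) \<phi>"
  using LIMSEQ_subseq_LIMSEQ[OF _ assms(2)] assms(1) unfolding weakly_tendsto_def o_def by blast

section \<open>Averages along geometric time scales\<close>

text \<open>For \<open>p \<ge> 1\<close> the ratio of consecutive terms is at least \<open>1 + 1/p\<close> and tends to it.\<close>

primrec growth_seq :: "nat \<Rightarrow> nat \<Rightarrow> nat" where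
  "growth_seq p 0 = 1"
| "growth_seq p (Suc l) = growth_seq p l + growth_seq p l div p + 1"

lemma strict_mono_growth_seq: "strict_mono (growth_seq p)"
  by (simp add: strict_mono_Suc_iff)

lemma growth_seq_pos: "growth_seq p l > 0"
  by (induction l) auto

lemma growth_seq_lower:
  assumes "p \<ge> 1"
  shows "(1 + 1 / real p) * real (growth_seq p l) \<le> real (growth_seq p (Suc l))"
proof -
  define k where "k = growth_seq p l"
  have "k < (k div p + 1) * p"
    using assms by (simp add: dividend_less_div_times)
  then have "real k \<le> (real (k div p) + 1) * real p"
    by (metis less_imp_le of_nat_1 of_nat_add of_nat_le_iff of_nat_mult)
  then show ?thesis
    using assms by (simp add: k_def[symmetric] field_simps)
qed

text \<open>Rounding adds 1 to a step of at most k / p; once k \<ge> p this 1 is itself at most k /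
  p, whence 2 / p.\<close>

lemma growth_seq_upper:
  assumes "p \<ge> 1" "growth_seq p l \<ge> p"
  shows "real (growth_seq p (Suc l)) \<le> (1 + 2 / real p) * real (growth_seq p l)"
proof -
  define k where "k = growth_seq p l"
  have "real (k div p) \<le> real k / real p"
    by (rule of_nat_div_le_of_nat)
  moreover have "1 \<le> real k / real p"
    using assms by (simp add: k_def)
  moreover have "(1 + 2 / real p) * real k = real k + (real k / real p + real k / real p)"
    by (simp add: algebra_simps)
  ultimately show ?thesis
    by (simp add: k_def[symmetric])
qed

text \<open>Summing the recursion puts \<rho> times the same partial sum on the right, where it is
  absorbed because \<rho> < 1.\<close>

lemma summable_of_contraction:
  fixes c d :: "nat \<Rightarrow> real"
  assumes "\<And>l. c l \<ge> 0" "\<And>l. c (Suc l) \<le> \<rho> * c l + d l" "\<rho> < 1"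
    and d: "\<And>l. (\<Sum>i<l. d i) \<le> D"
  shows "summable c"
proof (rule summableI_nonneg_bounded)
  show "(\<Sum>l<L. c l) \<le> (c 0 + D) / (1 - \<rho>)" for L
  proof -
    have "(\<Sum>l<L. c l) \<le> (\<Sum>l<Suc L. c l)"
      using assms(1) by simp
    also have "\<dots> = c 0 + (\<Sum>l<L. c (Suc l))"
      by (rule sum.lessThan_Suc_shift)
    also have "(\<Sum>l<L. c (Suc l)) \<le> (\<Sum>l<L. \<rho> * c l + d l)"
      by (rule sum_mono) (rule assms)
    also have "\<dots> \<le> \<rho> * (\<Sum>l<L. c l) + D"
      using d[of L] by (simp add: sum.distrib sum_distrib_left)
    finally show ?thesis
      using \<open>\<rho> < 1\<close> by (simp add: field_simps)
  qed
qed (rule assms)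

text \<open>A recursion replaces the usual exchange of the two sums: passing to the next time
  divides the old quotient by at least (1 + 1/p)^2, while the new block contributes at most its own
  share of the sum of w. The constant A leaves room for the cross terms.\<close>

lemma summable_growth_seq_moments:
  fixes w :: "nat \<Rightarrow> real"
  assumes w: "\<And>n. w n \<ge> 0" "summable w" and "A \<ge> 0" "p \<ge> 1"
  shows "summable (\<lambda>l. (A + (\<Sum>n<growth_seq p l. (real (Suc n))\<^sup>2 * w n)) / (real (growth_seq p l))\<^sup>2)"
    (is "summable ?c")
proof (rule summable_of_contraction)
  let ?k = "growth_seq p"
  let ?V = "\<lambda>l. A + (\<Sum>n<?k l. (real (Suc n))\<^sup>2 * w n)"
  define d where "d l = (\<Sum>n=?k l..<?k (Suc l). w n)" for l
  have mono: "?k l \<le> ?k (Suc l)" for l by simp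
  have V_nonneg: "?V l \<ge> 0" for l
    using w \<open>A \<ge> 0\<close> by (intro add_nonneg_nonneg sum_nonneg) auto
  then show "?c l \<ge> 0" for l by simp
  show "?c (Suc l) \<le> 1 / (1 + 1 / real p)\<^sup>2 * ?c l + d l" for l
  proof -
    let ?ka = "real (?k l)" and ?kb = "real (?k (Suc l))"
    have pos: "?ka > 0" "?kb > 0" using growth_seq_pos by (simp_all del: growth_seq.simps)
    have "?V (Suc l) = ?V l + (\<Sum>n=?k l..<?k (Suc l). (real (Suc n))\<^sup>2 * w n)"
      unfolding lessThan_atLeast0
      by (subst sum.atLeastLessThan_concat[OF _ mono, symmetric]) auto
    also have "(\<Sum>n=?k l..<?k (Suc l). (real (Suc n))\<^sup>2 * w n) \<le> (\<Sum>n=?k l..<?k (Suc l). ?kb\<^sup>2 * w n)"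
      by (intro sum_mono mult_right_mono power_mono w) (auto simp del: growth_seq.simps)
    also have "\<dots> = ?kb\<^sup>2 * d l"
      by (simp add: d_def sum_distrib_left del: growth_seq.simps)
    finally have "?c (Suc l) \<le> (?V l + ?kb\<^sup>2 * d l) / ?kb\<^sup>2"
      by (rule divide_right_mono) auto
    also have "\<dots> = ?V l / ?kb\<^sup>2 + d l"
      using pos by (simp add: add_divide_distrib del: growth_seq.simps)
    also have "?V l / ?kb\<^sup>2 \<le> ?V l / ((1 + 1 / real p) * ?ka)\<^sup>2"
      using growth_seq_lower[OF \<open>p \<ge> 1\<close>, of l] pos V_nonneg \<open>p \<ge> 1\<close>
      by (intro divide_left_mono power_mono mult_pos_pos zero_less_power mult_nonneg_nonneg add_pos_nonneg)
         (simp_all del: growth_seq.simps)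
    also have "\<dots> = 1 / (1 + 1 / real p)\<^sup>2 * ?c l"
      by (simp add: power_mult_distrib)
    finally show ?thesis by simp
  qed
  show "1 / (1 + 1 / real p)\<^sup>2 < 1"
  proof -
    have "1 < (1 + 1 / real p)\<^sup>2"
      by (rule one_less_power) (use \<open>p \<ge> 1\<close> in auto)
    then show ?thesis
      by (metis divide_less_eq_1_pos less_trans zero_less_one)
  qed
  show "(\<Sum>i<l. d i) \<le> suminf w" for l
  proof -
    have "(\<Sum>i<l. d i) + (\<Sum>n<?k 0. w n) = (\<Sum>n<?k l. w n)"
    proof (induction l)
      case (Suc l)
      have "(\<Sum>n<?k (Suc l). w n) = (\<Sum>n<?k l. w n) + d l"
        unfolding lessThan_atLeast0 d_def
        by (subst sum.atLeastLessThan_concat[OF _ mono, symmetric]) auto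
      then show ?case using Suc by (simp del: growth_seq.simps)
    qed simp
    moreover have "(\<Sum>n<?k 0. w n) \<ge> 0" using w by (intro sum_nonneg)
    moreover have "(\<Sum>n<?k l. w n) \<le> suminf w" using w by (intro sum_le_suminf) auto
    ultimately show ?thesis by linarith
  qed
qed

text \<open>Partial sums of nonnegative terms increase, so the average at N is trapped between the
  averages at the two neighbouring times, up to their ratio 1 + 2/p. A large p makes both this ratio
  and the tolerance 1/p harmless.\<close>

lemma cesaro_tendsto_of_growth_seqs:
  fixes a :: "nat \<Rightarrow> real"
  assumes a: "\<And>n. a n \<ge> 0"
    and lim: "\<And>p. p \<ge> 1 \<Longrightarrow> (\<lambda>l. (\<Sum>n<growth_seq p l. a n) / real (growth_seq p l)) \<longlonglongrightarrow> L"
  shows "(\<lambda>N. (\<Sum>n<N. a n) / real N) \<longlonglongrightarrow> L"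
proof (rule LIMSEQ_I)
  fix e :: real assume "e > 0"
  have inv: "(\<lambda>p. c / real p) \<longlonglongrightarrow> 0" for c
    by (rule lim_const_over_n)
  have "(\<lambda>p. (L + 1 / real p) * (1 + 2 / real p)) \<longlonglongrightarrow> (L + 0) * (1 + 0)"
    by (intro tendsto_intros inv)
  then have "\<forall>\<^sub>F p in sequentially. (L + 1 / real p) * (1 + 2 / real p) < L + e"
    using \<open>e > 0\<close> by (intro order_tendstoD(2)) auto
  moreover have "(\<lambda>p. (L - 1 / real p) / (1 + 2 / real p)) \<longlonglongrightarrow> (L - 0) / (1 + 0)"
    by (intro tendsto_intros inv) auto
  then have "\<forall>\<^sub>F p in sequentially. (L - 1 / real p) / (1 + 2 / real p) > L - e"
    using \<open>e > 0\<close> by (intro order_tendstoD(1)) auto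
  ultimately have "\<forall>\<^sub>F p in sequentially. p \<ge> 1 \<and> (L + 1 / real p) * (1 + 2 / real p) < L + e
      \<and> (L - 1 / real p) / (1 + 2 / real p) > L - e"
    using eventually_ge_at_top[of 1] by eventually_elim auto
  then obtain p where p: "p \<ge> 1" "(L + 1 / real p) * (1 + 2 / real p) < L + e"
    "(L - 1 / real p) / (1 + 2 / real p) > L - e"
    by (auto dest: eventually_happens)
  let ?k = "growth_seq p" and ?S = "\<lambda>N. \<Sum>n<N. a n"
  have "\<forall>\<^sub>F l in sequentially. dist (?S (?k l) / real (?k l)) L < 1 / real p"
    using p(1) by (intro tendstoD lim) auto
  then obtain l1 where l1: "\<And>l. l \<ge> l1 \<Longrightarrow> \<bar>?S (?k l) / real (?k l) - L\<bar> < 1 / real p"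
    unfolding eventually_sequentially dist_real_def by blast
  \<comment> \<open>From index p on the times are at least p, as \<open>growth_seq_upper\<close>
    requires.\<close>
  define l0 where "l0 = max l1 p"
  have "\<bar>?S N / real N - L\<bar> < e" if N: "N \<ge> ?k l0" for N
  proof -
    define l' where "l' = (LEAST l. N < ?k l)"
    have "N < ?k (Suc N)" using seq_suble[OF strict_mono_growth_seq[of p], of "Suc N"] by simp
    then have l': "N < ?k l'" unfolding l'_def by (rule LeastI)
    have "l0 < l'"
      using N l' strict_mono_less[OF strict_mono_growth_seq] by (meson le_less_trans)
    then obtain l where l: "l' = Suc l" "l \<ge> l0" by (cases l') auto
    have "?k l \<le> N"
      using not_less_Least[of l "\<lambda>l. N < ?k l"] l(1) by (simp add: l'_def[symmetric])
    let ?ka = "real (?k l)" and ?kb = "real (?k (Suc l))"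
    have "?k l \<ge> p"
      using seq_suble[OF strict_mono_growth_seq[of p], of l] l(2) by (simp add: l0_def)
    have k: "0 < ?ka" "?ka \<le> real N" "real N \<le> ?kb" "?kb \<le> (1 + 2 / real p) * ?ka"
      using growth_seq_pos[of p l] \<open>?k l \<le> N\<close> l' l(1) growth_seq_upper[OF p(1) \<open>?k l \<ge> p\<close>]
      by (simp_all del: growth_seq.simps)
    have S: "?S (?k l) \<le> ?S N" "?S N \<le> ?S (?k (Suc l))" "0 \<le> ?S (?k l)" "0 \<le> ?S (?k (Suc l))"
      using k a by (auto intro!: sum_mono2 sum_nonneg simp del: growth_seq.simps)
    have q: "\<bar>?S (?k l) / ?ka - L\<bar> < 1 / real p" "\<bar>?S (?k (Suc l)) / ?kb - L\<bar> < 1 / real p"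
      using l1[of l] l1[of "Suc l"] l(2) by (simp_all add: l0_def del: growth_seq.simps)
    have "?S N / real N \<le> ?S (?k (Suc l)) / ?ka"
      using k S by (intro frac_le) auto
    also have "\<dots> = ?S (?k (Suc l)) / ?kb * (?kb / ?ka)"
      using k by simp
    also have "\<dots> \<le> (L + 1 / real p) * (1 + 2 / real p)"
    proof (rule mult_mono)
      show le: "?S (?k (Suc l)) / ?kb \<le> L + 1 / real p" using q(2) by linarith
      show "?kb / ?ka \<le> 1 + 2 / real p" using k by (simp only: pos_divide_le_eq)
      have "0 \<le> ?S (?k (Suc l)) / ?kb" using k S by (intro divide_nonneg_nonneg) auto
      then show "0 \<le> L + 1 / real p" using le by linarith
      show "0 \<le> ?kb / ?ka" by simp
    qed
    finally have upper: "?S N / real N < L + e" using p(2) by simp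
    have "(L - 1 / real p) / (1 + 2 / real p) \<le> (?S (?k l) / ?ka) / (1 + 2 / real p)"
      using q(1) by (intro divide_right_mono) auto
    also have "\<dots> = ?S (?k l) / ((1 + 2 / real p) * ?ka)"
      by (simp add: mult.commute)
    also have "\<dots> \<le> ?S N / real N"
      using k S by (intro frac_le) auto
    finally have "L - e < ?S N / real N" using p(3) by simp
    with upper show ?thesis by (simp add: abs_less_iff)
  qed
  then show "\<exists>no. \<forall>N\<ge>no. norm (?S N / real N - L) < e"
    by auto
qed

text \<open>The terms with n + 1 < x equal 1 and there are about x of them; the later ones, x^2 /
  (n+1)^2, have a tail of order x. After taking expectations, this bounds normalised second moments
  of truncations by the first moment, uniformly over all functions.\<close>

lemma sum_truncated_squares_le:
  fixes x :: real
  assumes "x \<ge> 0"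
  shows "(\<Sum>n<N. (min x (real (Suc n)))\<^sup>2 / (real (Suc n))\<^sup>2) \<le> 3 * x"
proof -
  let ?s = "\<lambda>N. \<Sum>n<N. (min x (real (Suc n)))\<^sup>2 / (real (Suc n))\<^sup>2"
  have small: "?s N \<le> real N" for N
  proof -
    have "?s N \<le> (\<Sum>n<N. 1)"
    proof (rule sum_mono)
      fix n
      have "(min x (real (Suc n)))\<^sup>2 \<le> (real (Suc n))\<^sup>2"
        using assms by (intro power_mono) auto
      then show "(min x (real (Suc n)))\<^sup>2 / (real (Suc n))\<^sup>2 \<le> 1"
        by (simp add: divide_le_eq_1)
    qed
    then show ?thesis by simp
  qed
  \<comment> \<open>The subtracted x^2 / (N + 1) is a reserve for the tail: the next term is paid by
    1 / (N + 1) - 1 / (N + 2), so the induction closes by telescoping.\<close>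
  have "?s (Suc N) \<le> 3 * x - x\<^sup>2 / real (Suc N)" if "x \<le> real (Suc N)" for N
    using that
  proof (induction N)
    case 0
    then have "x\<^sup>2 \<le> x" using assms by (simp add: power2_eq_square mult_left_le)
    then show ?case using 0 assms by simp
  next
    case (Suc N)
    let ?N = "real (Suc N)" and ?N' = "real (Suc (Suc N))"
    have last: "(min x ?N')\<^sup>2 / ?N'\<^sup>2 = x\<^sup>2 / ?N'\<^sup>2"
      using Suc.prems by (simp add: min_def)
    show ?case
    proof (cases "x \<le> ?N")
      case True
      have "x\<^sup>2 / ?N'\<^sup>2 \<le> x\<^sup>2 * (1 / ?N - 1 / ?N')"
      proof -
        have "1 / ?N'\<^sup>2 \<le> 1 / (?N * ?N')"
          unfolding power2_eq_square by (intro frac_le mult_mono mult_pos_pos) auto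
        also have "\<dots> = 1 / ?N - 1 / ?N'" by (simp add: field_simps)
        finally have "1 / ?N'\<^sup>2 \<le> 1 / ?N - 1 / ?N'" .
        then have "x\<^sup>2 * (1 / ?N'\<^sup>2) \<le> x\<^sup>2 * (1 / ?N - 1 / ?N')"
          by (rule mult_left_mono) simp
        then show ?thesis by simp
      qed
      then have "x\<^sup>2 / ?N'\<^sup>2 \<le> x\<^sup>2 / ?N - x\<^sup>2 / ?N'" by (simp add: right_diff_distrib)
      moreover have "?s (Suc (Suc N)) = ?s (Suc N) + x\<^sup>2 / ?N'\<^sup>2"
        using last by simp
      ultimately show ?thesis using Suc.IH[OF True] by linarith
    next
      case False
      \<comment> \<open>Here N + 2 is the first integer not below x. The earlier terms are counted
        by \<open>small\<close>, giving at most x, and the last term and the reserve cost at most 1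
        \<le> x and x.\<close>
      have "x\<^sup>2 \<le> x * ?N'" using Suc.prems assms by (simp add: power2_eq_square mult_left_mono)
      then have "x\<^sup>2 / ?N' \<le> x" by (simp add: divide_le_eq)
      moreover have "x\<^sup>2 / ?N'\<^sup>2 \<le> 1"
        using Suc.prems assms by (simp add: divide_le_eq_1 power_mono)
      moreover have "?s (Suc (Suc N)) = ?s (Suc N) + x\<^sup>2 / ?N'\<^sup>2"
        using last by simp
      moreover have "?s (Suc N) \<le> ?N" by (rule small)
      moreover have "?N < x" "1 \<le> ?N" using False by auto
      ultimately show ?thesis by linarith
    qed
  qed
  note large = this
  show ?thesis
  proof (cases "x \<le> real N")
    case True
    show ?thesis
    proof (cases N)
      case (Suc N')
      then have "?s N \<le> 3 * x - x\<^sup>2 / real N" using large[of N'] True by simp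
      also have "\<dots> \<le> 3 * x" by simp
      finally show ?thesis .
    qed (use assms in simp)
  next
    case False
    then show ?thesis using small[of N] assms by linarith
  qed
qed

section \<open>Komlos's theorem\<close>

context prob_space
begin

lemma AE_incseq_tendsto_of_bounded_expectations:
  fixes \<phi> :: "nat \<Rightarrow> 'a \<Rightarrow> real"
  assumes [measurable]: "\<And>n. \<phi> n \<in> borel_measurable M"
    and nonneg: "AE x in M. \<forall>n. 0 \<le> \<phi> n x" and mono: "AE x in M. \<forall>n. \<phi> n x \<le> \<phi> (Suc n) x"
    and bound: "\<And>n. (\<integral>\<^sup>+x. ennreal (\<phi> n x) \<partial>M) \<le> ennreal K"
  shows "AE x in M. (\<lambda>n. \<phi> n x) \<longlonglongrightarrow> lim (\<lambda>n. \<phi> n x)"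
proof -
  have "(\<integral>\<^sup>+x. (SUP n. ennreal (\<phi> n x)) \<partial>M) = (SUP n. \<integral>\<^sup>+x. ennreal (\<phi> n x) \<partial>M)"
  proof (rule nn_integral_monotone_convergence_SUP_AE)
    show "AE x in M. ennreal (\<phi> n x) \<le> ennreal (\<phi> (Suc n) x)" for n
      using mono by eventually_elim (auto intro: ennreal_leI)
  qed measurable
  also have "\<dots> \<le> ennreal K" by (intro SUP_least bound)
  finally have "(\<integral>\<^sup>+x. (SUP n. ennreal (\<phi> n x)) \<partial>M) \<noteq> \<infinity>"
    by (auto simp: top_unique)
  then have "AE x in M. (SUP n. ennreal (\<phi> n x)) \<noteq> \<infinity>"
    by (intro nn_integral_noteq_infinite) auto
  with nonneg mono show ?thesis
  proof eventually_elim
    case (elim x)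
    then obtain B where B: "(SUP n. ennreal (\<phi> n x)) = ennreal B" "B \<ge> 0"
      by (metis ennreal_cases infinity_ennreal_def)
    have "\<phi> n x \<le> B" for n
      using SUP_upper[of n UNIV "\<lambda>n. ennreal (\<phi> n x)"] elim B by (auto simp: ennreal_le_iff)
    moreover have "incseq (\<lambda>n. \<phi> n x)"
      using elim by (intro incseq_SucI) auto
    ultimately have "convergent (\<lambda>n. \<phi> n x)"
      by (metis convergentI incseq_convergent)
    then show ?case by (simp add: convergent_LIMSEQ_iff)
  qed
qed

text \<open>This is Etemadi's proof of the strong law: truncate the \<open>n\<close>-th term at level \<open>n + 1\<close>, centre it
  by the weak limit at that level, control second moments along geometric subsequences of times, and
  fill the gaps by monotonicity. Only pairwise almost orthogonality is needed, and this can be arranged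
  for all subsequences simultaneously.\<close>

lemma komlos_nonneg:
  fixes f :: "nat \<Rightarrow> 'a \<Rightarrow> real"
  assumes f [measurable]: "\<And>n. f n \<in> borel_measurable M" and f_nonneg: "\<And>n x. 0 \<le> f n x"
    and f_bound: "\<And>n. (\<integral>\<^sup>+x. ennreal (f n x) \<partial>M) \<le> ennreal K" and "K \<ge> 0"
  obtains r :: "nat \<Rightarrow> nat" and fs where "strict_mono r" "fs \<in> borel_measurable M"
    "\<And>s. strict_mono s \<Longrightarrow> cesaro_ae M (f \<circ> r \<circ> s) fs"
proof -
  define G0 where "G0 n m x = min (f m x) (real (Suc n))" for n m x
  have G0_meas: "G0 n m \<in> borel_measurable M" for n m
    unfolding G0_def by measurable
  have G0_bd: "0 \<le> G0 n m x" "\<bar>G0 n m x\<bar> \<le> real (Suc n)" for n m x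
    using f_nonneg[of m x] by (auto simp: G0_def)
  have bdd_G0: "bdd_measurable M (G0 n m)" for n m
    by (rule bdd_measurableI[OF G0_meas G0_bd(2)])
  obtain r1 :: "nat \<Rightarrow> nat" and \<phi> where r1: "strict_mono r1"
    and \<phi> [measurable]: "\<And>n. \<phi> n \<in> borel_measurable M" and \<phi>_bd: "\<And>n x. \<bar>\<phi> n x\<bar> \<le> real (Suc n)"
    and weak1: "\<And>n. weakly_tendsto M (\<lambda>m. G0 n (r1 m)) (\<phi> n)"
    by (rule weakly_convergent_array[of G0 "\<lambda>n. real (Suc n)", OF G0_meas G0_bd(2)]) blast
  \<comment> \<open>The normalisation makes these numbers at most 1, so a diagonal choice lets them
    converge for every level n.\<close>
  define v where "v n m = (\<integral>x. (G0 n (r1 m) x)\<^sup>2 \<partial>M) / (real (Suc n))\<^sup>2" for n m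
  have "\<bar>\<integral>x. (G0 n m x)\<^sup>2 \<partial>M\<bar> \<le> (real (Suc n))\<^sup>2" for n m
    using G0_bd by (intro abs_expectation_le bdd_measurable_intros bdd_G0) (auto intro!: power_mono simp: abs_le_iff)
  then have "Bseq (v n)" for n
    by (intro BseqI'[of _ 1]) (auto simp: v_def divide_le_eq)
  then obtain r2 where r2: "strict_mono r2" "\<And>n. convergent (\<lambda>m. v n (r2 m))"
    by (rule diagonal_convergent_subseq[of v]) blast
  define g where "g m = f (r1 (r2 m))" for m
  define G where "G n m = G0 n (r1 (r2 m))" for n m
  define u where "u n = lim (\<lambda>m. v n (r2 m))" for n
  have g [measurable]: "g m \<in> borel_measurable M" for m by (simp add: g_def)
  have G_eq: "G n m x = min (g m x) (real (Suc n))" for n m x by (simp add: G_def G0_def g_def)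
  have G_bd: "0 \<le> G n m x" "\<bar>G n m x\<bar> \<le> real (Suc n)" for n m x
    using G0_bd by (auto simp: G_def)
  have G [measurable]: "G n m \<in> borel_measurable M" for n m using G0_meas by (simp add: G_def)
  have bdd_G: "bdd_measurable M (G n m)" and bdd_\<phi>: "bdd_measurable M (\<phi> n)" for n m
    by (rule bdd_measurableI[OF G G_bd(2)] bdd_measurableI[OF \<phi> \<phi>_bd])+
  note bdd = bdd_measurable_intros bdd_G bdd_\<phi>
  have weak: "weakly_tendsto M (G n) (\<phi> n)" for n
    using weakly_tendsto_subseq[OF weak1 r2(1)] by (simp add: G_def[abs_def])
  have weakD: "(\<lambda>m. \<integral>x. G n m x * h x \<partial>M) \<longlonglongrightarrow> (\<integral>x. \<phi> n x * h x \<partial>M)" if "bdd_measurable M h" for n h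
    using weak that unfolding weakly_tendsto_def by blast
  have u_lim: "(\<lambda>m. (\<integral>x. (G n m x)\<^sup>2 \<partial>M) / (real (Suc n))\<^sup>2) \<longlonglongrightarrow> u n" for n
    using r2(2)[of n] by (simp add: u_def convergent_LIMSEQ_iff v_def G_def)
  have u_nonneg: "u n \<ge> 0" for n
    using u_lim by (rule LIMSEQ_le_const) auto
  have g_int: "integrable M (g m)" "(\<integral>x. g m x \<partial>M) \<le> K" for m
  proof -
    have bd: "(\<integral>\<^sup>+x. ennreal (g m x) \<partial>M) \<le> ennreal K" using f_bound by (simp add: g_def)
    then show "integrable M (g m)"
      using f_nonneg by (intro integrableI_nonneg) (auto simp: g_def less_top[symmetric] top_unique)
    then have "ennreal (\<integral>x. g m x \<partial>M) \<le> ennreal K"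
      using bd f_nonneg by (subst nn_integral_eq_integral[symmetric]) (auto simp: g_def)
    then show "(\<integral>x. g m x \<partial>M) \<le> K"
      using \<open>K \<ge> 0\<close> by (simp add: ennreal_le_iff)
  qed
  \<comment> \<open>For fixed m the sum over finitely many levels is at most 3 K by
    \<open>sum_truncated_squares_le\<close>; only then m tends to infinity. The order matters, since
    no single function attains all the limits \<open>u n\<close>.\<close>
  have u_sum: "summable u"
  proof (rule summableI_nonneg_bounded)
    show "(\<Sum>n<N. u n) \<le> 3 * K" for N
    proof (rule LIMSEQ_le_const2)
      show "(\<lambda>m. \<Sum>n<N. (\<integral>x. (G n m x)\<^sup>2 \<partial>M) / (real (Suc n))\<^sup>2) \<longlonglongrightarrow> (\<Sum>n<N. u n)"
        by (intro tendsto_sum u_lim)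
      have "(\<Sum>n<N. (\<integral>x. (G n m x)\<^sup>2 \<partial>M) / (real (Suc n))\<^sup>2) \<le> 3 * K" for m
      proof -
        have i: "integrable M (\<lambda>x. (G n m x)\<^sup>2 / (real (Suc n))\<^sup>2)" for n
          by (intro integrable_bdd bdd)
        have "(\<Sum>n<N. (\<integral>x. (G n m x)\<^sup>2 \<partial>M) / (real (Suc n))\<^sup>2)
            = (\<integral>x. (\<Sum>n<N. (G n m x)\<^sup>2 / (real (Suc n))\<^sup>2) \<partial>M)"
          by (subst Bochner_Integration.integral_sum[OF i]) simp
        also have "\<dots> \<le> (\<integral>x. 3 * g m x \<partial>M)"
          using f_nonneg
          by (intro integral_mono Bochner_Integration.integrable_sum i integrable_mult_right g_int)
             (simp only: G_eq, rule sum_truncated_squares_le, simp add: g_def)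
        also have "\<dots> \<le> 3 * K" using g_int(2)[of m] by simp
        finally show ?thesis .
      qed
      then show "\<exists>N'. \<forall>m\<ge>N'. (\<Sum>n<N. (\<integral>x. (G n m x)\<^sup>2 \<partial>M) / (real (Suc n))\<^sup>2) \<le> 3 * K"
        by blast
    qed
  qed (rule u_nonneg)

  \<comment> \<open>Truncations increase with the level, hence so do their weak limits almost
    everywhere, and K bounds the integrals. So this limit exists and is finite almost
    everywhere.\<close>
  define fs where "fs x = lim (\<lambda>n. \<phi> n x)" for x
  have \<phi>_nonneg: "AE x in M. \<forall>n. 0 \<le> \<phi> n x"
  proof (subst AE_all_countable, intro allI)
    fix n
    show "AE x in M. 0 \<le> \<phi> n x"
      by (rule weakly_tendsto_mono[of "\<lambda>_ _. 0" "\<lambda>_. 0" "G n" "\<phi> n"])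
         (auto simp: weakly_tendsto_def[of M "\<lambda>_ _. 0"] weak G_bd intro!: bdd)
  qed
  have \<phi>_mono: "AE x in M. \<forall>n. \<phi> n x \<le> \<phi> (Suc n) x"
  proof (subst AE_all_countable, intro allI)
    fix n
    show "AE x in M. \<phi> n x \<le> \<phi> (Suc n) x"
      by (rule weakly_tendsto_mono[OF weak weak bdd_G bdd_G bdd_\<phi> bdd_\<phi>]) (auto simp: G_eq)
  qed
  have \<phi>_lim: "AE x in M. (\<lambda>n. \<phi> n x) \<longlonglongrightarrow> fs x"
    unfolding fs_def
  proof (rule AE_incseq_tendsto_of_bounded_expectations[OF \<phi> \<phi>_nonneg \<phi>_mono])
    fix n
    have "(\<integral>x. \<phi> n x * 1 \<partial>M) \<le> K"
      using weakD[OF bdd_measurable_const]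
    proof (rule LIMSEQ_le_const2)
      have "(\<integral>x. G n m x * 1 \<partial>M) \<le> K" for m
      proof -
        have "(\<integral>x. G n m x * 1 \<partial>M) \<le> (\<integral>x. g m x \<partial>M)"
          by (intro integral_mono integrable_bdd bdd g_int) (simp add: G_eq)
        then show ?thesis using g_int(2)[of m] by linarith
      qed
      then show "\<exists>N. \<forall>m\<ge>N. (\<integral>x. G n m x * 1 \<partial>M) \<le> K" by blast
    qed
    moreover have "(\<integral>\<^sup>+x. ennreal (\<phi> n x) \<partial>M) = ennreal (\<integral>x. \<phi> n x \<partial>M)"
      using \<phi>_nonneg by (intro nn_integral_eq_integral integrable_bdd bdd) auto
    ultimately show "(\<integral>\<^sup>+x. ennreal (\<phi> n x) \<partial>M) \<le> ennreal K"
      by (auto intro: ennreal_leI)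
  qed

  \<comment> \<open>The slack 2^-n puts the limit \<open>u n\<close> strictly below
    \<open>w n\<close>, so that the estimates hold for all large m, and keeps \<open>w\<close>
    summable.\<close>
  define w where "w n = u n + (1/2)^n" for n
  have w_nonneg: "w n \<ge> 0" for n using u_nonneg by (simp add: w_def)
  have w_sum: "summable w" unfolding w_def by (intro summable_add u_sum summable_geometric) auto
  \<comment> \<open>The new function may be needed at any level n \<le> t, and an earlier one at any
    smaller level, hence the quantifiers over n and i. The tolerance \<open>(1/4)^t\<close> is the
    one that \<open>sum_geometric_pairs_le\<close> asks for.\<close>
  define P where "P t \<rho> m \<longleftrightarrow>
      (\<forall>n\<in>{..t}. (\<integral>x. (G n m x)\<^sup>2 \<partial>M) < (real (Suc n))\<^sup>2 * w n
         \<and> (\<integral>x. (G n m x - \<phi> n x)\<^sup>2 \<partial>M) < (real (Suc n))\<^sup>2 * w n)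
      \<and> (\<forall>j\<in>{..<t}. \<forall>i\<in>{..t}. \<forall>n\<in>{..t}.
           (\<integral>x. (G n m x - \<phi> n x) * (G i (\<rho> j) x - \<phi> i x) \<partial>M) < (1/4)^t)"
    for t \<rho> m
  obtain r3 where r3: "strict_mono r3" and r3P: "\<And>t. P t r3 (r3 t)"
  proof (rule strict_mono_select[of P])
    show "P t \<rho> m \<longleftrightarrow> P t \<rho>' m" if "\<And>i. i < t \<Longrightarrow> \<rho> i = \<rho>' i" for t \<rho> \<rho>' m
      using that unfolding P_def by auto
  next
    fix t :: nat and \<rho> :: "nat \<Rightarrow> nat"
    have lt: "(real (Suc n))\<^sup>2 * u n < (real (Suc n))\<^sup>2 * w n" for n
      by (simp add: w_def)
    have sq_lim: "(\<lambda>m. \<integral>x. (G n m x)\<^sup>2 \<partial>M) \<longlonglongrightarrow> (real (Suc n))\<^sup>2 * u n" for n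
      using tendsto_mult_left[OF u_lim[of n], of "(real (Suc n))\<^sup>2"] by simp
    have "\<forall>\<^sub>F m in sequentially. (\<integral>x. (G n m x - \<phi> n x)\<^sup>2 \<partial>M) < (real (Suc n))\<^sup>2 * w n" for n
    proof -
      \<comment> \<open>Centring at the weak limit can only lower the limiting second moment: the
        cross term contributes twice the square of \<phi>, with negative sign.\<close>
      have "(\<lambda>m. (\<integral>x. (G n m x)\<^sup>2 \<partial>M) - 2 * (\<integral>x. G n m x * \<phi> n x \<partial>M) + (\<integral>x. \<phi> n x * \<phi> n x \<partial>M))
          \<longlonglongrightarrow> (real (Suc n))\<^sup>2 * u n - 2 * (\<integral>x. \<phi> n x * \<phi> n x \<partial>M) + (\<integral>x. \<phi> n x * \<phi> n x \<partial>M)"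
        by (intro tendsto_intros sq_lim weakD bdd)
      moreover have "(\<integral>x. (G n m x)\<^sup>2 \<partial>M) - 2 * (\<integral>x. G n m x * \<phi> n x \<partial>M) + (\<integral>x. \<phi> n x * \<phi> n x \<partial>M)
          = (\<integral>x. (G n m x - \<phi> n x)\<^sup>2 \<partial>M)" for m
      proof -
        have "integrable M (\<lambda>x. (G n m x)\<^sup>2)" "integrable M (\<lambda>x. G n m x * \<phi> n x)" "integrable M (\<lambda>x. \<phi> n x * \<phi> n x)"
          by (intro integrable_bdd bdd)+
        then have "(\<integral>x. (G n m x)\<^sup>2 \<partial>M) - 2 * (\<integral>x. G n m x * \<phi> n x \<partial>M) + (\<integral>x. \<phi> n x * \<phi> n x \<partial>M)
            = (\<integral>x. (G n m x)\<^sup>2 - 2 * (G n m x * \<phi> n x) + \<phi> n x * \<phi> n x \<partial>M)"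
          by simp
        then show ?thesis by (simp add: power2_eq_square algebra_simps)
      qed
      ultimately have "(\<lambda>m. \<integral>x. (G n m x - \<phi> n x)\<^sup>2 \<partial>M)
          \<longlonglongrightarrow> (real (Suc n))\<^sup>2 * u n - (\<integral>x. \<phi> n x * \<phi> n x \<partial>M)"
        by simp
      moreover have "(\<integral>x. \<phi> n x * \<phi> n x \<partial>M) \<ge> 0"
        by (intro Bochner_Integration.integral_nonneg) auto
      then have "(real (Suc n))\<^sup>2 * u n - (\<integral>x. \<phi> n x * \<phi> n x \<partial>M) < (real (Suc n))\<^sup>2 * w n"
        using lt[of n] by linarith
      ultimately show ?thesis by (rule order_tendstoD(2))
    qed
    then have "\<forall>\<^sub>F m in sequentially. \<forall>n\<in>{..t}. (\<integral>x. (G n m x)\<^sup>2 \<partial>M) < (real (Suc n))\<^sup>2 * w n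
         \<and> (\<integral>x. (G n m x - \<phi> n x)\<^sup>2 \<partial>M) < (real (Suc n))\<^sup>2 * w n"
      using order_tendstoD(2)[OF sq_lim lt]
      by (intro eventually_ball_finite) (auto intro: eventually_conj)
    \<comment> \<open>The centred earlier function is a fixed bounded test function, against which
      the centred new one tends weakly to 0.\<close>
    moreover have "\<forall>\<^sub>F m in sequentially. \<forall>j\<in>{..<t}. \<forall>i\<in>{..t}. \<forall>n\<in>{..t}.
           (\<integral>x. (G n m x - \<phi> n x) * (G i (\<rho> j) x - \<phi> i x) \<partial>M) < (1/4)^t"
    proof (intro eventually_ball_finite ballI; simp?)
      fix j i n
      let ?h = "\<lambda>x. G i (\<rho> j) x - \<phi> i x"
      have h: "bdd_measurable M ?h" by (intro bdd)
      have "(\<lambda>m. (\<integral>x. G n m x * ?h x \<partial>M) - (\<integral>x. \<phi> n x * ?h x \<partial>M))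
          \<longlonglongrightarrow> (\<integral>x. \<phi> n x * ?h x \<partial>M) - (\<integral>x. \<phi> n x * ?h x \<partial>M)"
        by (intro tendsto_intros weakD h)
      moreover have "(\<integral>x. G n m x * ?h x \<partial>M) - (\<integral>x. \<phi> n x * ?h x \<partial>M)
          = (\<integral>x. (G n m x - \<phi> n x) * ?h x \<partial>M)" for m
      proof -
        have "integrable M (\<lambda>x. G n m x * ?h x)" "integrable M (\<lambda>x. \<phi> n x * ?h x)"
          by (intro integrable_bdd bdd)+
        then have "(\<integral>x. G n m x * ?h x \<partial>M) - (\<integral>x. \<phi> n x * ?h x \<partial>M)
            = (\<integral>x. G n m x * ?h x - \<phi> n x * ?h x \<partial>M)"
          by (rule Bochner_Integration.integral_diff[symmetric])
        then show ?thesis by (simp only: left_diff_distrib)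
      qed
      ultimately have "(\<lambda>m. \<integral>x. (G n m x - \<phi> n x) * ?h x \<partial>M) \<longlonglongrightarrow> 0"
        by simp
      then show "\<forall>\<^sub>F m in sequentially. (\<integral>x. (G n m x - \<phi> n x) * ?h x \<partial>M) < (1/4)^t"
        by (rule order_tendstoD(2)) simp
    qed
    ultimately show "eventually (P t \<rho>) sequentially"
      unfolding P_def by eventually_elim blast
  qed auto

  define r where "r = r1 \<circ> r2 \<circ> r3"
  have r: "strict_mono r"
    unfolding r_def by (intro strict_mono_o r1 r2 r3)
  have "cesaro_ae M (f \<circ> r \<circ> s) fs" if s: "strict_mono s" for s
  proof -
    define m where "m n = r3 (s n)" for n
    \<comment> \<open>Place n of the further subsequence is filled at stage \<open>s n\<close>, so
      this inequality puts level n among those controlled there.\<close>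
    have s_ge: "n \<le> s n" for n using s by (rule seq_suble)
    define Y where "Y n x = G n (m n) x - \<phi> n x" for n x
    have bdd_Y: "bdd_measurable M (Y n)" for n
      unfolding Y_def by (intro bdd)
    have G_sq: "(\<integral>x. (G n (m n) x)\<^sup>2 \<partial>M) \<le> (real (Suc n))\<^sup>2 * w n" for n
      using r3P[of "s n", unfolded P_def, THEN conjunct1, rule_format, of n] s_ge[of n]
      unfolding m_def by simp
    have Y_sq: "(\<integral>x. (Y n x)\<^sup>2 \<partial>M) \<le> (real (Suc n))\<^sup>2 * w n" for n
      using r3P[of "s n", unfolded P_def, THEN conjunct1, rule_format, of n] s_ge[of n]
      unfolding m_def Y_def by simp
    have cross: "(\<integral>x. Y i x * Y n x \<partial>M) \<le> (1/4)^n" if "i < n" for i n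
    proof -
      have "s i < s n" using s that by (rule strict_monoD)
      then have "(\<integral>x. Y n x * Y i x \<partial>M) < (1/4)^(s n)"
        using r3P[of "s n"] s_ge[of n] that unfolding P_def m_def Y_def by auto
      also have "(1/4)^(s n) \<le> (1/4::real)^n"
        using s_ge by (intro power_decreasing) auto
      finally show ?thesis by (simp add: mult.commute)
    qed
    have sums: "AE x in M. \<forall>p. p \<ge> 1 \<longrightarrow>
        (\<lambda>l. (\<Sum>n<growth_seq p l. Y n x) / real (growth_seq p l)) \<longlonglongrightarrow> 0"
    proof (subst AE_all_countable, intro allI)
      fix p :: nat
      let ?k = "growth_seq p"
      have "AE x in M. (\<lambda>l. (\<Sum>n<?k l. Y n x) / real (?k l)) \<longlonglongrightarrow> 0" if "p \<ge> 1"
      proof (rule AE_tendsto_0_if_summable_second_moments)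
        show "bdd_measurable M (\<lambda>x. (\<Sum>n<?k l. Y n x) / real (?k l))" for l
          by (intro bdd bdd_Y)
        show "summable (\<lambda>l. \<integral>x. ((\<Sum>n<?k l. Y n x) / real (?k l))\<^sup>2 \<partial>M)"
        proof (rule summable_comparison_test)
          show "summable (\<lambda>l. (4 + (\<Sum>n<?k l. (real (Suc n))\<^sup>2 * w n)) / (real (?k l))\<^sup>2)"
            using that by (intro summable_growth_seq_moments w_nonneg w_sum) auto
          have "(\<integral>x. ((\<Sum>n<?k l. Y n x) / real (?k l))\<^sup>2 \<partial>M)
              \<le> (4 + (\<Sum>n<?k l. (real (Suc n))\<^sup>2 * w n)) / (real (?k l))\<^sup>2" for l
          proof -
            have "(\<integral>x. (\<Sum>n<?k l. Y n x)\<^sup>2 \<partial>M) \<le> (\<Sum>n<?k l. \<integral>x. (Y n x)\<^sup>2 \<partial>M) + 4"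
              by (rule expectation_sum_square_le[OF bdd_Y cross])
            also have "(\<Sum>n<?k l. \<integral>x. (Y n x)\<^sup>2 \<partial>M) \<le> (\<Sum>n<?k l. (real (Suc n))\<^sup>2 * w n)"
              by (rule sum_mono) (rule Y_sq)
            finally have "(\<integral>x. (\<Sum>n<?k l. Y n x)\<^sup>2 \<partial>M) / (real (?k l))\<^sup>2
                \<le> (4 + (\<Sum>n<?k l. (real (Suc n))\<^sup>2 * w n)) / (real (?k l))\<^sup>2"
              by (intro divide_right_mono) auto
            then show ?thesis by (simp add: power_divide)
          qed
          then show "\<exists>L. \<forall>l\<ge>L. norm (\<integral>x. ((\<Sum>n<?k l. Y n x) / real (?k l))\<^sup>2 \<partial>M)
              \<le> (4 + (\<Sum>n<?k l. (real (Suc n))\<^sup>2 * w n)) / (real (?k l))\<^sup>2"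
            by auto
        qed
      qed
      then show "AE x in M. p \<ge> 1 \<longrightarrow> (\<lambda>l. (\<Sum>n<?k l. Y n x) / real (?k l)) \<longlonglongrightarrow> 0"
        by (cases "p \<ge> 1") auto
    qed
    define E where "E n = {x \<in> space M. real (Suc n) < g (m n) x}" for n
    have E [measurable]: "E n \<in> sets M" for n unfolding E_def by measurable
    have "AE x in M. eventually (\<lambda>n. x \<in> space M - E n) sequentially"
    proof (rule borel_cantelli_AE1[OF E])
      show "emeasure M (E n) < \<infinity>" for n by (simp add: less_top[symmetric])
      show "summable (\<lambda>n. measure M (E n))"
      proof (rule summable_comparison_test)
        show "summable w" by fact
        \<comment> \<open>On \<open>E n\<close> the truncated function equals n + 1, so Chebyshev's
          inequality with the second moment bound also controls the truncation error.\<close>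
        have "measure M (E n) \<le> w n" for n
        proof -
          have "(real (Suc n))\<^sup>2 * measure M (E n) = (\<integral>x. (real (Suc n))\<^sup>2 * indicator (E n) x \<partial>M)"
            by simp
          also have "\<dots> \<le> (\<integral>x. (G n (m n) x)\<^sup>2 \<partial>M)"
          proof (intro integral_mono integrable_bdd bdd E)
            show "(real (Suc n))\<^sup>2 * indicator (E n) x \<le> (G n (m n) x)\<^sup>2" for x
              by (auto simp: indicator_def E_def G_eq)
          qed
          also have "\<dots> \<le> (real (Suc n))\<^sup>2 * w n" by (rule G_sq)
          finally show ?thesis by (simp add: mult_le_cancel_left)
        qed
        then show "\<exists>N. \<forall>n\<ge>N. norm (measure M (E n)) \<le> w n"
          by (auto simp: measure_nonneg)
      qed
    qed
    with sums \<phi>_lim show ?thesis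
      unfolding cesaro_ae_def
    proof eventually_elim
      case (elim x)
      \<comment> \<open>The averages of the centred terms vanish along each growth sequence, and
        those of the centrings \<open>\<phi> n x\<close> tend to \<open>fs x\<close>. The gaps are
        filled for the uncentred truncations, which are nonnegative.\<close>
      have "(\<lambda>N. (\<Sum>n<N. G n (m n) x) / real N) \<longlonglongrightarrow> fs x"
      proof (rule cesaro_tendsto_of_growth_seqs)
        show "0 \<le> G n (m n) x" for n by (rule G_bd)
        fix p :: nat assume "p \<ge> 1"
        then have "(\<lambda>l. (\<Sum>n<growth_seq p l. Y n x) / real (growth_seq p l)
            + (\<Sum>n<growth_seq p l. \<phi> n x) / real (growth_seq p l)) \<longlonglongrightarrow> 0 + fs x"
          using elim LIMSEQ_subseq_LIMSEQ[OF cesaro_tendsto[OF elim(2)] strict_mono_growth_seq[of p]]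
          by (intro tendsto_add) (auto simp: o_def)
        then show "(\<lambda>l. (\<Sum>n<growth_seq p l. G n (m n) x) / real (growth_seq p l)) \<longlonglongrightarrow> fs x"
          by (simp add: Y_def sum_subtractf diff_divide_distrib)
      qed
      moreover have "eventually (\<lambda>n. G n (m n) x = g (m n) x) sequentially"
        using elim(3) by eventually_elim (auto simp: E_def G_eq)
      ultimately have "(\<lambda>N. (\<Sum>n<N. g (m n) x) / real N) \<longlonglongrightarrow> fs x"
        by (rule cesaro_tendsto_cong[rotated])
      then show ?case
        by (simp add: g_def m_def r_def o_def)
    qed
  qed
  moreover have "fs \<in> borel_measurable M" unfolding fs_def by measurable
  ultimately show ?thesis using that r by blast
qed

text \<open>Positive parts are treated first; the conclusion for all further subsequences survives
  the second extraction, made for the negative parts.\<close>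

lemma komlos:
  fixes f :: "nat \<Rightarrow> 'a \<Rightarrow> real"
  assumes f [measurable]: "\<And>n. f n \<in> borel_measurable M"
    and f_bound: "(SUP n. \<integral>\<^sup>+x. ennreal \<bar>f n x\<bar> \<partial>M) < \<infinity>"
  obtains r :: "nat \<Rightarrow> nat" and fs where "strict_mono r" "fs \<in> borel_measurable M"
    "\<And>s. strict_mono s \<Longrightarrow> cesaro_ae M (f \<circ> r \<circ> s) fs"
proof -
  obtain K where K: "K \<ge> 0" "(SUP n. \<integral>\<^sup>+x. ennreal \<bar>f n x\<bar> \<partial>M) = ennreal K"
    using f_bound by (metis ennreal_cases infinity_ennreal_def less_irrefl)
  have bound: "(\<integral>\<^sup>+x. ennreal (h x) \<partial>M) \<le> ennreal K" if "\<And>x. h x \<le> \<bar>f n x\<bar>" for h n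
  proof -
    have "(\<integral>\<^sup>+x. ennreal (h x) \<partial>M) \<le> (\<integral>\<^sup>+x. ennreal \<bar>f n x\<bar> \<partial>M)"
      by (intro nn_integral_mono ennreal_leI that)
    also have "\<dots> \<le> ennreal K" unfolding K(2)[symmetric] by (rule SUP_upper) simp
    finally show ?thesis .
  qed
  have bound1: "(\<integral>\<^sup>+x. ennreal (max 0 (f n x)) \<partial>M) \<le> ennreal K" for n
    by (rule bound[of _ n]) auto
  have meas1: "(\<lambda>x. max 0 (f n x)) \<in> borel_measurable M" for n by measurable
  obtain r1 :: "nat \<Rightarrow> nat" and fp where r1: "strict_mono r1" and fp [measurable]: "fp \<in> borel_measurable M"
    and r1_lim: "\<And>s. strict_mono s \<Longrightarrow> cesaro_ae M ((\<lambda>n x. max 0 (f n x)) \<circ> r1 \<circ> s) fp"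
    by (rule komlos_nonneg[of "\<lambda>n x. max 0 (f n x)" K, OF meas1 _ bound1 K(1)]) (rule max.cobounded1, blast)
  have bound2: "(\<integral>\<^sup>+x. ennreal (max 0 (- f (r1 n) x)) \<partial>M) \<le> ennreal K" for n
    by (rule bound[of _ "r1 n"]) auto
  have meas2: "(\<lambda>x. max 0 (- f (r1 n) x)) \<in> borel_measurable M" for n by measurable
  obtain r2 :: "nat \<Rightarrow> nat" and fm where r2: "strict_mono r2" and fm [measurable]: "fm \<in> borel_measurable M"
    and r2_lim: "\<And>s. strict_mono s \<Longrightarrow> cesaro_ae M ((\<lambda>n x. max 0 (- f (r1 n) x)) \<circ> r2 \<circ> s) fm"
    by (rule komlos_nonneg[of "\<lambda>n x. max 0 (- f (r1 n) x)" K, OF meas2 _ bound2 K(1)]) (rule max.cobounded1, blast)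
  have "cesaro_ae M (f \<circ> (r1 \<circ> r2) \<circ> s) (\<lambda>x. fp x - fm x)" if s: "strict_mono s" for s
    using r1_lim[OF strict_mono_o[OF r2 s]] r2_lim[OF s]
    unfolding cesaro_ae_def
  proof eventually_elim
    case (elim x)
    have split: "max 0 a - max 0 (- a) = a" for a :: real by auto
    have "(\<lambda>N. (\<Sum>n<N. max 0 (f (r1 (r2 (s n))) x)) / real N
        - (\<Sum>n<N. max 0 (- f (r1 (r2 (s n))) x)) / real N) \<longlonglongrightarrow> fp x - fm x"
      using elim by (intro tendsto_diff) (auto simp: o_def)
    then show ?case
      by (simp add: o_def sum_subtractf[symmetric] diff_divide_distrib[symmetric] split)
  qed
  moreover have "(\<lambda>x. fp x - fm x) \<in> borel_measurable M" by measurable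
  ultimately show ?thesis
    using that[of "r1 \<circ> r2"] strict_mono_o[OF r1 r2] by blast
qed

end

section \<open>Local boundedness and equivalent probability measures\<close>

context prob_space
begin

lemma exhausting_seqI:
  assumes "\<And>j. A j \<in> sets M" "incseq A" "AE x in M. \<exists>j. x \<in> A j"
  shows "exhausting_seq M A"
proof -
  have "prob (\<Union>j. A j) = 1"
    using assms by (subst prob_eq_1) auto
  with finite_Lim_measure_incseq[of A] assms show ?thesis
    unfolding exhausting_seq_def by auto
qed

lemma AE_exhausting_seq:
  assumes "exhausting_seq M A"
  shows "AE x in M. \<exists>j. x \<in> A j"
proof -
  have A: "range A \<subseteq> sets M" "incseq A" "(\<lambda>j. prob (A j)) \<longlonglongrightarrow> 1"
    using assms unfolding exhausting_seq_def by auto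
  then have "prob (\<Union>j. A j) = 1"
    using LIMSEQ_unique finite_Lim_measure_incseq by blast
  then show ?thesis
    using A by (subst (asm) prob_eq_1) auto
qed

lemma equiv_prob_of_loc_L1_bounded:
  assumes g [measurable]: "\<And>n. g n \<in> borel_measurable M"
    and A: "exhausting_seq M A" and bounded: "loc_L1_bounded M g A"
  obtains Q where "equiv_prob M Q" "(SUP n. \<integral>\<^sup>+x. ennreal \<bar>g n x\<bar> \<partial>Q) < \<infinity>"
proof -
  have [measurable]: "A j \<in> sets M" for j using A unfolding exhausting_seq_def by auto
  define K where "K j = enn2real (SUP n. \<integral>\<^sup>+x. ennreal (\<bar>g n x\<bar> * indicator (A j) x) \<partial>M)" for j
  have K: "K j \<ge> 0"
    "(SUP n. \<integral>\<^sup>+x. ennreal (\<bar>g n x\<bar> * indicator (A j) x) \<partial>M) = ennreal (K j)" for j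
    using bounded unfolding loc_L1_bounded_def K_def
    by (auto simp only: enn2real_nonneg ennreal_enn2real infinity_ennreal_def)
  have K_le: "(\<integral>\<^sup>+x. ennreal (\<bar>g n x\<bar> * indicator (A j) x) \<partial>M) \<le> ennreal (K j)" for n j
    unfolding K(2)[symmetric] by (rule SUP_upper) simp
  \<comment> \<open>The weights satisfy two bounds by 2^-(j+1): on \<open>wt j\<close> itself, which
    makes the total mass at most 1, and on \<open>wt j * K j\<close>, which makes the weighted
    integrals at most 1. The 1 in the denominator serves the first bound and covers K j = 0.\<close>
  define wt where "wt j = (1/2)^Suc j / (1 + K j)" for j
  have wt: "wt j > 0" "wt j \<le> (1/2)^Suc j" "wt j * K j \<le> (1/2)^Suc j" for j
  proof -
    have "1 + K j > 0" using K(1)[of j] by simp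
    then show "wt j > 0" unfolding wt_def by (intro divide_pos_pos) auto
    have "wt j * (1 + K j) = (1/2)^Suc j"
      using \<open>1 + K j > 0\<close> nonzero_eq_divide_eq[of "1 + K j" "wt j" "(1/2)^Suc j"] by (simp only: wt_def) simp
    moreover have "wt j * K j \<ge> 0" using \<open>wt j > 0\<close> K(1)[of j] by simp
    ultimately show "wt j \<le> (1/2)^Suc j" "wt j * K j \<le> (1/2)^Suc j"
      using \<open>wt j > 0\<close> unfolding distrib_left mult_1_right by linarith+
  qed
  define Z where "Z x = (\<Sum>j. ennreal (wt j * indicator (A j) x))" for x
  have [measurable]: "Z \<in> borel_measurable M" unfolding Z_def by measurable
  have geo: "(\<Sum>j. ennreal ((1/2)^Suc j)) = 1"
  proof -
    have "(\<Sum>j. ennreal ((1/2)^Suc j)) = ennreal (\<Sum>j. (1/2)^Suc j)"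
      by (rule suminf_ennreal2[OF _ sums_summable[OF power_half_series]]) (rule zero_le_power, simp)
    also have "(\<Sum>j. (1/2)^Suc j) = (1::real)"
      by (rule sums_unique[OF power_half_series, symmetric])
    finally show ?thesis by simp
  qed
  \<comment> \<open>Positivity of the density outside an M-null set is what makes Q equivalent to M
    and not merely absolutely continuous.\<close>
  have Z_pos: "AE x in M. Z x \<noteq> 0"
    using AE_exhausting_seq[OF A]
  proof eventually_elim
    case (elim x)
    then obtain j where "x \<in> A j" by blast
    then have "ennreal (wt j) \<le> Z x"
      using sum_le_suminf[of "\<lambda>j. ennreal (wt j * indicator (A j) x)" "{j}"] by (simp add: Z_def)
    moreover have "ennreal (wt j) > 0" using wt(1)[of j] by simp
    ultimately show ?case by auto
  qed
  define c where "c = (\<integral>\<^sup>+x. Z x \<partial>M)"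
  have "c \<le> (\<integral>\<^sup>+x. (\<Sum>j. ennreal ((1/2)^Suc j)) \<partial>M)"
    unfolding c_def Z_def
    by (intro nn_integral_mono suminf_le)
       (use wt in \<open>auto intro!: ennreal_leI simp: indicator_def less_imp_le\<close>)
  also have "\<dots> = 1" unfolding geo by (simp add: emeasure_space_1)
  finally have c_le: "c \<le> 1" .
  then have "c \<noteq> \<infinity>" by (auto simp: top_unique)
  have "c \<noteq> 0"
  proof
    assume "c = 0"
    then have "AE x in M. Z x = 0" unfolding c_def by (subst (asm) nn_integral_0_iff_AE) auto
    with Z_pos have "AE x in M. False" by eventually_elim auto
    then show False by simp
  qed
  define Q where "Q = density M (\<lambda>x. Z x / c)"
  have Q_eq: "(\<integral>\<^sup>+x. h x \<partial>Q) = (\<integral>\<^sup>+x. Z x * h x \<partial>M) / c" if [measurable]: "h \<in> borel_measurable M" for h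
  proof -
    have "(\<integral>\<^sup>+x. h x \<partial>Q) = (\<integral>\<^sup>+x. Z x / c * h x \<partial>M)"
      unfolding Q_def by (rule nn_integral_density) auto
    also have "\<dots> = (\<integral>\<^sup>+x. Z x * h x / c \<partial>M)"
      by (simp add: ennreal_times_divide mult.commute)
    also have "\<dots> = (\<integral>\<^sup>+x. Z x * h x \<partial>M) / c"
      by (rule nn_integral_divide) auto
    finally show ?thesis .
  qed
  show ?thesis
  proof
    show "equiv_prob M Q"
      unfolding equiv_prob_def
    proof (intro conjI ballI)
      have "emeasure Q (space Q) = (\<integral>\<^sup>+x. 1 \<partial>Q)" by simp
      also have "\<dots> = c / c" by (subst Q_eq) (auto simp: c_def)
      also have "\<dots> = 1" using \<open>c \<noteq> 0\<close> \<open>c \<noteq> \<infinity>\<close>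
        by (intro ennreal_divide_self) (auto simp: less_top)
      finally show "prob_space Q" by (rule prob_spaceI)
      show "space Q = space M" "sets Q = sets M" by (auto simp: Q_def)
      fix B assume B [measurable]: "B \<in> sets M"
      have "emeasure Q B = (\<integral>\<^sup>+x. indicator B x \<partial>Q)"
        using B by (simp add: Q_def)
      also have "\<dots> = (\<integral>\<^sup>+x. Z x * indicator B x \<partial>M) / c"
        by (rule Q_eq) measurable
      finally have "emeasure Q B = 0 \<longleftrightarrow> (\<integral>\<^sup>+x. Z x * indicator B x \<partial>M) = 0"
        using \<open>c \<noteq> \<infinity>\<close> by (simp add: ennreal_divide_eq_0_iff)
      also have "\<dots> \<longleftrightarrow> (AE x in M. Z x * indicator B x = 0)"
        by (rule nn_integral_0_iff_AE) measurable
      also have "\<dots> \<longleftrightarrow> (AE x in M. x \<notin> B)"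
      proof
        assume "AE x in M. Z x * indicator B x = 0"
        with Z_pos show "AE x in M. x \<notin> B" by eventually_elim (auto simp: indicator_def)
      next
        assume "AE x in M. x \<notin> B"
        then show "AE x in M. Z x * indicator B x = 0" by eventually_elim simp
      qed
      also have "\<dots> \<longleftrightarrow> emeasure M B = 0"
      proof -
        have "{x \<in> space M. \<not> x \<notin> B} = B" using sets.sets_into_space[OF B] by auto
        then show ?thesis by (subst AE_iff_measurable[of B M]) auto
      qed
      finally show "emeasure M B = 0 \<longleftrightarrow> emeasure Q B = 0" by simp
    qed
    have "(\<integral>\<^sup>+x. ennreal \<bar>g n x\<bar> \<partial>Q) \<le> 1 / c" for n
    proof -
      have "(\<integral>\<^sup>+x. Z x * ennreal \<bar>g n x\<bar> \<partial>M)
          = (\<integral>\<^sup>+x. (\<Sum>j. ennreal (wt j) * ennreal (\<bar>g n x\<bar> * indicator (A j) x)) \<partial>M)"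
      proof (rule nn_integral_cong)
        fix x
        have "Z x * ennreal \<bar>g n x\<bar> = (\<Sum>j. ennreal (wt j * indicator (A j) x) * ennreal \<bar>g n x\<bar>)"
          unfolding Z_def by simp
        also have "\<dots> = (\<Sum>j. ennreal (wt j) * ennreal (\<bar>g n x\<bar> * indicator (A j) x))"
          using wt(1) by (intro suminf_cong) (simp add: less_imp_le mult_ac flip: ennreal_mult)
        finally show "Z x * ennreal \<bar>g n x\<bar> = (\<Sum>j. ennreal (wt j) * ennreal (\<bar>g n x\<bar> * indicator (A j) x))" .
      qed
      also have "\<dots> = (\<Sum>j. ennreal (wt j) * (\<integral>\<^sup>+x. ennreal (\<bar>g n x\<bar> * indicator (A j) x) \<partial>M))"
        by (subst nn_integral_suminf) (auto simp: nn_integral_cmult)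
      also have "\<dots> \<le> (\<Sum>j. ennreal ((1/2)^Suc j))"
      proof (intro suminf_le)
        fix j
        have "ennreal (wt j) * (\<integral>\<^sup>+x. ennreal (\<bar>g n x\<bar> * indicator (A j) x) \<partial>M) \<le> ennreal (wt j) * ennreal (K j)"
          by (intro mult_left_mono K_le) auto
        also have "\<dots> = ennreal (wt j * K j)"
          using wt(1)[of j] K(1)[of j] by (simp add: ennreal_mult)
        also have "\<dots> \<le> ennreal ((1/2)^Suc j)" by (intro ennreal_leI wt)
        finally show "ennreal (wt j) * (\<integral>\<^sup>+x. ennreal (\<bar>g n x\<bar> * indicator (A j) x) \<partial>M) \<le> ennreal ((1/2)^Suc j)" .
      qed auto
      finally have "(\<integral>\<^sup>+x. Z x * ennreal \<bar>g n x\<bar> \<partial>M) \<le> 1" by (simp only: geo)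
      moreover have "(\<lambda>x. ennreal \<bar>g n x\<bar>) \<in> borel_measurable M" by measurable
      ultimately show ?thesis
        by (simp only: Q_eq divide_right_mono_ennreal)
    qed
    then have "(SUP n. \<integral>\<^sup>+x. ennreal \<bar>g n x\<bar> \<partial>Q) \<le> 1 / c" by (intro SUP_least)
    also have "1 / c < \<infinity>" using \<open>c \<noteq> 0\<close> by (simp add: ennreal_divide_eq_top_iff less_top[symmetric])
    finally show "(SUP n. \<integral>\<^sup>+x. ennreal \<bar>g n x\<bar> \<partial>Q) < \<infinity>" .
  qed
qed

lemma loc_L1_bounded_of_equiv_prob:
  assumes g [measurable]: "\<And>n. g n \<in> borel_measurable M"
    and Q: "equiv_prob M Q" and bounded: "(SUP n. \<integral>\<^sup>+x. ennreal \<bar>g n x\<bar> \<partial>Q) < \<infinity>"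
  obtains A where "exhausting_seq M A" "loc_L1_bounded M g A"
proof -
  interpret Q: prob_space Q using Q unfolding equiv_prob_def by auto
  have sets_Q [measurable_cong]: "sets Q = sets M" and space_Q: "space Q = space M"
    using Q unfolding equiv_prob_def by auto
  have ac: "absolutely_continuous Q M"
    using Q unfolding equiv_prob_def absolutely_continuous_def null_sets_def by auto
  define Z where "Z = RN_deriv Q M"
  have [measurable]: "Z \<in> borel_measurable M" "Z \<in> borel_measurable Q"
    unfolding Z_def by (auto simp: measurable_cong_sets[OF sets_Q refl, symmetric])
  have M_eq: "density Q Z = M"
    unfolding Z_def by (rule Q.density_RN_deriv[OF ac sets_Q[symmetric]])
  have "AE x in Q. Z x \<noteq> \<infinity>"
    unfolding Z_def by (rule Q.RN_deriv_finite[OF sigma_finite_measure_axioms ac sets_Q[symmetric]])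
  \<comment> \<open>Finiteness is obtained under Q, the reference measure of the density, but the
    sets \<open>A j\<close> have to exhaust under M.\<close>
  then have Z_fin: "AE x in M. Z x \<noteq> \<infinity>"
    by (rule absolutely_continuous_AE[OF sets_Q[symmetric] ac])
  define A where "A j = {x \<in> space M. Z x \<le> of_nat j}" for j :: nat
  have [measurable]: "A j \<in> sets M" for j unfolding A_def by measurable
  show ?thesis
  proof
    show "exhausting_seq M A"
    proof (rule exhausting_seqI)
      show "incseq A"
        unfolding A_def incseq_def by (auto intro: order_trans)
      show "AE x in M. \<exists>j. x \<in> A j"
        using Z_fin AE_space
      proof eventually_elim
        case (elim x)
        then obtain j :: nat where "Z x \<le> of_nat j"
          by (metis ennreal_Ex_less_of_nat infinity_ennreal_def less_imp_le less_top)
        then show ?case using elim by (auto simp: A_def)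
      qed
    qed measurable
    show "loc_L1_bounded M g A"
      unfolding loc_L1_bounded_def
    proof
      fix j
      let ?S = "SUP n. \<integral>\<^sup>+x. ennreal \<bar>g n x\<bar> \<partial>Q"
      have "(\<integral>\<^sup>+x. ennreal (\<bar>g n x\<bar> * indicator (A j) x) \<partial>M) \<le> of_nat j * ?S" for n
      proof -
        have "(\<integral>\<^sup>+x. ennreal (\<bar>g n x\<bar> * indicator (A j) x) \<partial>M)
            = (\<integral>\<^sup>+x. ennreal (\<bar>g n x\<bar> * indicator (A j) x) \<partial>density Q Z)"
          by (simp add: M_eq)
        also have "\<dots> = (\<integral>\<^sup>+x. Z x * ennreal (\<bar>g n x\<bar> * indicator (A j) x) \<partial>Q)"
          by (rule nn_integral_density) measurable
        also have "\<dots> \<le> (\<integral>\<^sup>+x. of_nat j * ennreal \<bar>g n x\<bar> \<partial>Q)"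
          by (rule nn_integral_mono) (auto simp: A_def indicator_def intro!: mult_right_mono)
        also have "\<dots> = of_nat j * (\<integral>\<^sup>+x. ennreal \<bar>g n x\<bar> \<partial>Q)"
          by (rule nn_integral_cmult) measurable
        also have "\<dots> \<le> of_nat j * ?S"
          by (intro mult_left_mono SUP_upper) auto
        finally show ?thesis .
      qed
      then have "(SUP n. \<integral>\<^sup>+x. ennreal (\<bar>g n x\<bar> * indicator (A j) x) \<partial>M) \<le> of_nat j * ?S"
        by (rule SUP_least)
      also have "\<dots> < \<infinity>"
        using bounded by (simp add: ennreal_mult_less_top of_nat_less_top)
      finally show "(SUP n. \<integral>\<^sup>+x. ennreal (\<bar>g n x\<bar> * indicator (A j) x) \<partial>M) < \<infinity>" .
    qed
  qed
qed

text \<open>Almost everywhere convergence depends on the null sets only, so the conclusion under Q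
  carries over to M.\<close>

lemma komlos_of_loc_L1_bounded:
  assumes g: "\<And>n. g n \<in> borel_measurable M"
    and A: "exhausting_seq M A" and bounded: "loc_L1_bounded M g A"
  obtains r :: "nat \<Rightarrow> nat" and fs where "strict_mono r" "fs \<in> borel_measurable M"
    "\<And>s. strict_mono s \<Longrightarrow> cesaro_ae M (g \<circ> r \<circ> s) fs"
proof -
  obtain Q where Q: "equiv_prob M Q" "(SUP n. \<integral>\<^sup>+x. ennreal \<bar>g n x\<bar> \<partial>Q) < \<infinity>"
    using equiv_prob_of_loc_L1_bounded[OF g A bounded] by blast
  interpret Q: prob_space Q using Q unfolding equiv_prob_def by auto
  have sets_Q: "sets Q = sets M" and ac: "absolutely_continuous Q M"
    using Q unfolding equiv_prob_def absolutely_continuous_def null_sets_def by auto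
  obtain r :: "nat \<Rightarrow> nat" and fs where "strict_mono r" "fs \<in> borel_measurable Q"
    "\<And>s. strict_mono s \<Longrightarrow> cesaro_ae Q (g \<circ> r \<circ> s) fs"
    by (rule Q.komlos[OF _ Q(2)]) (use g in \<open>auto simp: measurable_cong_sets[OF sets_Q refl]\<close>)
  then show ?thesis
    using absolutely_continuous_AE[OF sets_Q[symmetric] ac]
    by (intro that[of r fs]) (auto simp: cesaro_ae_def measurable_cong_sets[OF sets_Q refl])
qed

end

section \<open>From hereditary convergence to local boundedness\<close>

text \<open>A discrete layer-cake bound: the sum counts the positive integers up to y, cut off at C,
  and y \<le> 1 + C keeps the loss within 1.\<close>

lemma le_Suc_sum_thresholds:
  fixes y :: real
  assumes "y \<le> 1 + real C"
  shows "y \<le> 1 + (\<Sum>c<C. of_bool (real (Suc c) \<le> y))"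
  using assms
proof (induction C)
  case (Suc C)
  show ?case
  proof (cases "y \<le> 1 + real C")
    case True
    then show ?thesis using Suc.IH by (auto simp: add_increasing2)
  next
    case False
    then have "(\<Sum>c<Suc C. of_bool (real (Suc c) \<le> y)) = (\<Sum>c<Suc C. 1 :: real)"
      by (intro sum.cong) auto
    then show ?thesis using Suc.prems by simp
  qed
qed simp

context prob_space
begin

text \<open>If the limiting probabilities \<open>p\<close> of the events \<open>E c m\<close> have a divergent sum on \<open>B\<close>, choosing the
  sequence \<open>r\<close> sparsely enough makes these events nearly independent given the values of \<open>p\<close>, and the
  divergence half of the Borel--Cantelli lemma applies.\<close>

lemma weak_borel_cantelli:
  fixes E :: "nat \<Rightarrow> nat \<Rightarrow> 'a set"
  assumes E [measurable]: "\<And>c m. E c m \<in> sets M" and B [measurable]: "B \<in> sets M"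
    and p [measurable]: "\<And>c. p c \<in> borel_measurable M" and p01: "\<And>c x. 0 \<le> p c x" "\<And>c x. p c x \<le> 1"
    and weak: "\<And>c. weakly_tendsto M (\<lambda>m. indicator (E c m)) (p c)"
    and unbdd: "\<And>x j. x \<in> B \<Longrightarrow> \<exists>C. real j < (\<Sum>c<C. p c x)"
  obtains r :: "nat \<Rightarrow> nat" where "strict_mono r" "AE x in M. x \<in> B \<longrightarrow> (\<exists>\<^sub>F n in sequentially. x \<in> E n (r n))"
proof -
  define I where "I c m = (indicator (E c m) :: 'a \<Rightarrow> real)" for c m
  have bdd_I: "bdd_measurable M (I c m)" for c m
    unfolding I_def by (rule bdd_measurable_indicator) measurable
  have bdd_p: "bdd_measurable M (p c)" for c
    by (rule bdd_measurableI[of _ _ 1]) (use p p01 in auto)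
  note bdd = bdd_measurable_intros bdd_I bdd_p B
  \<comment> \<open>If the events were independent given the p c, this integral would be the
    probability that a point of B misses all events from a to N - 1. It depends on the limits alone,
    so the block ends \<open>N a\<close> are fixed before \<open>r\<close>.\<close>
  have "\<exists>N\<ge>a. (\<integral>x. indicator B x * (\<Prod>c=a..<N. 1 - p c x) \<partial>M) < (1/2)^a" for a
  proof -
    have "(\<lambda>N. \<integral>x. indicator B x * (\<Prod>c=a..<N. 1 - p c x) \<partial>M) \<longlonglongrightarrow> (\<integral>x. 0 \<partial>M)"
    proof (rule integral_dominated_convergence[where w = "\<lambda>_. 1"])
      have prod_bd: "0 \<le> (\<Prod>c=a..<N. 1 - p c x)" "(\<Prod>c=a..<N. 1 - p c x) \<le> 1" for N x
        using p01 by (auto intro!: prod_nonneg prod_le_1)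
      then show "AE x in M. norm (indicator B x * (\<Prod>c=a..<N. 1 - p c x)) \<le> 1" for N
        by (auto simp: indicator_def)
      show "AE x in M. (\<lambda>N. indicator B x * (\<Prod>c=a..<N. 1 - p c x)) \<longlonglongrightarrow> 0"
      proof (rule AE_I2)
        fix x
        show "(\<lambda>N. indicator B x * (\<Prod>c=a..<N. 1 - p c x)) \<longlonglongrightarrow> 0"
        proof (cases "x \<in> B")
          case True
          \<comment> \<open>The summand \<open>real a\<close> pays for the first a values of p, each
            at most 1, which do not occur in the product.\<close>
          have prod_le: "(\<Prod>c=a..<N. 1 - p c x) \<le> exp (real a - (\<Sum>c<N. p c x))" for N
          proof -
            have "(\<Prod>c=a..<N. 1 - p c x) \<le> (\<Prod>c=a..<N. exp (- p c x))"
              using p01 exp_ge_add_one_self[of "- p _ x"] by (intro prod_mono) auto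
            also have "\<dots> = exp (- (\<Sum>c=a..<N. p c x))"
              by (simp add: exp_sum sum_negf[symmetric])
            also have "\<dots> \<le> exp (real a - (\<Sum>c<N. p c x))"
            proof -
              have "(\<Sum>c<N. p c x) \<le> (\<Sum>c\<in>{..<a} \<union> {a..<N}. p c x)"
                using p01 by (intro sum_mono2) auto
              also have "\<dots> = (\<Sum>c<a. p c x) + (\<Sum>c=a..<N. p c x)"
                by (intro sum.union_disjoint) auto
              also have "(\<Sum>c<a. p c x) \<le> (\<Sum>c<a. 1)"
                using p01 by (intro sum_mono) auto
              finally show ?thesis by simp
            qed
            finally show ?thesis .
          qed
          have exp_lim: "(\<lambda>N. exp (real a - (\<Sum>c<N. p c x))) \<longlonglongrightarrow> 0"
          proof -
            have "filterlim (\<lambda>N. \<Sum>c<N. p c x) at_top sequentially"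
              unfolding filterlim_at_top eventually_sequentially
            proof
              fix K :: real
              obtain j :: nat where "K \<le> real j" using real_arch_simple by blast
              obtain C where "real j < (\<Sum>c<C. p c x)" using unbdd[OF True] by blast
              moreover have "(\<Sum>c<C. p c x) \<le> (\<Sum>c<N. p c x)" if "N \<ge> C" for N
                using p01 that by (intro sum_mono2) auto
              ultimately show "\<exists>C. \<forall>N\<ge>C. K \<le> (\<Sum>c<N. p c x)"
                using \<open>K \<le> real j\<close> by (intro exI[of _ C]) fastforce
            qed
            then have "filterlim (\<lambda>N. - real a + (\<Sum>c<N. p c x)) at_top sequentially"
              by (intro filterlim_tendsto_add_at_top[OF tendsto_const])
            then have "filterlim (\<lambda>N. - (- real a + (\<Sum>c<N. p c x))) at_bot sequentially"
              by (simp only: filterlim_uminus_at_top[symmetric])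
            then show ?thesis
              using filterlim_compose[OF exp_at_bot] by fastforce
          qed
          have "(\<lambda>N. \<Prod>c=a..<N. 1 - p c x) \<longlonglongrightarrow> 0"
            by (rule tendsto_sandwich[OF _ _ tendsto_const exp_lim]) (use prod_bd(1) prod_le in auto)
          then show ?thesis using True by simp
        qed simp
      qed
    qed auto
    then have "\<forall>\<^sub>F N in sequentially. (\<integral>x. indicator B x * (\<Prod>c=a..<N. 1 - p c x) \<partial>M) < (1/2)^a"
      by (rule order_tendstoD(2)) simp
    from eventually_happens[OF eventually_conj[OF eventually_ge_at_top[of a] this]]
    show ?thesis by auto
  qed
  then have "\<exists>N. \<forall>a. N a \<ge> a \<and> (\<integral>x. indicator B x * (\<Prod>c=a..<N a. 1 - p c x) \<partial>M) < (1/2)^a"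
    by (intro choice allI) auto
  then obtain N where N: "\<And>a. N a \<ge> a"
    "\<And>a. (\<integral>x. indicator B x * (\<Prod>c=a..<N a. 1 - p c x) \<partial>M) < (1/2)^a"
    by auto
  \<comment> \<open>Factors are exchanged one at a time. Those before b use events already chosen,
    those after b still use the limits, and factor b is left out, so H is a fixed bounded function
    when stage b begins. Exchanging factor b costs the integral bounded in P, which tends to 0 by
    weak convergence.\<close>
  define H where "H a b \<rho> x = indicator B x * (\<Prod>i=a..<b. 1 - I i (\<rho> i) x) * (\<Prod>c=Suc b..<N a. 1 - p c x)"
    for a b \<rho> x
  define P where "P b \<rho> m \<longleftrightarrow> (\<forall>a\<in>{..b}. (\<integral>x. (p b x - I b m x) * H a b \<rho> x \<partial>M) < (1/2)^b)" for b \<rho> m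
  obtain r where r: "strict_mono r" "\<And>b. P b r (r b)"
  proof (rule strict_mono_select[of P])
    show "P b \<rho> m \<longleftrightarrow> P b \<rho>' m" if "\<And>i. i < b \<Longrightarrow> \<rho> i = \<rho>' i" for b \<rho> \<rho>' m
    proof -
      have "H a b \<rho> = H a b \<rho>'" for a unfolding H_def using that by auto
      then show ?thesis by (simp add: P_def)
    qed
  next
    fix b :: nat and \<rho> :: "nat \<Rightarrow> nat"
    have "\<forall>\<^sub>F m in sequentially. (\<integral>x. (p b x - I b m x) * H a b \<rho> x \<partial>M) < (1/2)^b" for a
    proof -
      have bdd_H: "bdd_measurable M (H a b \<rho>)"
        unfolding H_def by (intro bdd)
      then have "(\<lambda>m. (\<integral>x. p b x * H a b \<rho> x \<partial>M) - (\<integral>x. I b m x * H a b \<rho> x \<partial>M))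
          \<longlonglongrightarrow> (\<integral>x. p b x * H a b \<rho> x \<partial>M) - (\<integral>x. p b x * H a b \<rho> x \<partial>M)"
        using weak[of b] unfolding weakly_tendsto_def I_def by (intro tendsto_intros) blast
      moreover have "(\<integral>x. p b x * H a b \<rho> x \<partial>M) - (\<integral>x. I b m x * H a b \<rho> x \<partial>M)
          = (\<integral>x. (p b x - I b m x) * H a b \<rho> x \<partial>M)" for m
        unfolding left_diff_distrib
        by (intro Bochner_Integration.integral_diff[symmetric] integrable_bdd bdd bdd_H)
      ultimately have "(\<lambda>m. \<integral>x. (p b x - I b m x) * H a b \<rho> x \<partial>M) \<longlonglongrightarrow> 0" by simp
      then show ?thesis by (rule order_tendstoD(2)) simp
    qed
    then show "eventually (P b \<rho>) sequentially"
      unfolding P_def[abs_def] by (intro eventually_ball_finite) auto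
  qed auto
  define Z where "Z a b x = indicator B x * (\<Prod>i=a..<b. 1 - I i (r i) x) * (\<Prod>c=b..<N a. 1 - p c x)" for a b x
  have bdd_Z: "bdd_measurable M (Z a b)" for a b
    unfolding Z_def by (intro bdd)
  have Z_step: "(\<integral>x. Z a (Suc b) x \<partial>M) \<le> (\<integral>x. Z a b x \<partial>M) + (1/2)^b" if "a \<le> b" "b < N a" for a b
  proof -
    have "Z a (Suc b) x - Z a b x = (p b x - I b (r b) x) * H a b r x" for x
      using that by (simp add: Z_def H_def prod.atLeast_Suc_lessThan[of b "N a"] algebra_simps)
    then have "(\<integral>x. Z a (Suc b) x \<partial>M) - (\<integral>x. Z a b x \<partial>M) = (\<integral>x. (p b x - I b (r b) x) * H a b r x \<partial>M)"
      by (subst Bochner_Integration.integral_diff[symmetric]) (auto intro: integrable_bdd bdd_Z)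
    also have "\<dots> < (1/2)^b"
      using r(2)[of b] that unfolding P_def by auto
    finally show ?thesis by simp
  qed
  \<comment> \<open>The value at b = a is below 2^-a by the choice of \<open>N a\<close>, and each
    exchange costs at most 2^-b = 2 * 2^-b - 2 * 2^-(b+1), so the costs telescope.\<close>
  have Z_bound: "(\<integral>x. Z a b x \<partial>M) \<le> 3 * (1/2)^a - 2 * (1/2)^b" if "a \<le> b" "b \<le> N a" for a b
    using that
  proof (induction b rule: dec_induct)
    case base
    then show ?case using N(2)[of a] by (simp add: Z_def)
  next
    case (step b)
    then show ?case using Z_step[of a b] by simp
  qed
  define F where "F a = B \<inter> (space M - (\<Union>i\<in>{a..<N a}. E i (r i)))" for a
  have [measurable]: "F a \<in> sets M" for a unfolding F_def by measurable
  have F_prob: "prob (F a) \<le> 3 * (1/2)^a" for a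
  proof -
    have "prob (F a) = (\<integral>x. indicator (F a) x \<partial>M)" by simp
    also have "\<dots> = (\<integral>x. Z a (N a) x \<partial>M)"
    proof (rule Bochner_Integration.integral_cong[OF refl])
      fix x assume "x \<in> space M"
      show "indicator (F a) x = Z a (N a) x"
      proof (cases "x \<in> F a")
        case True
        then have "x \<in> B" "\<forall>i\<in>{a..<N a}. x \<notin> E i (r i)"
          unfolding F_def by auto
        then show ?thesis using True by (simp add: Z_def I_def)
      next
        case False
        then have "x \<notin> B \<or> (\<exists>i\<in>{a..<N a}. 1 - I i (r i) x = 0)"
          using \<open>x \<in> space M\<close> by (auto simp: F_def I_def indicator_def)
        then have "Z a (N a) x = 0"
          by (auto simp: Z_def prod_zero_iff)
        then show ?thesis using False by simp
      qed
    qed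
    also have "\<dots> \<le> 3 * (1/2)^a - 2 * (1/2)^N a"
      using Z_bound N(1) by simp
    also have "\<dots> \<le> 3 * (1/2)^a" by simp
    finally show ?thesis .
  qed
  \<comment> \<open>The sets F a have summable probabilities, and a point of B outside F a meets an
    event with index at least a. Hence almost every point of B meets events of arbitrarily large
    index.\<close>
  have "AE x in M. eventually (\<lambda>a. x \<in> space M - F a) sequentially"
  proof (rule borel_cantelli_AE1)
    show "summable (\<lambda>a. prob (F a))"
      using F_prob
      by (intro summable_comparison_test'[OF summable_mult[OF summable_geometric[of "1/2"], of 3], of 0]) auto
  qed (auto simp: less_top[symmetric])
  then have "AE x in M. x \<in> B \<longrightarrow> (\<exists>\<^sub>F n in sequentially. x \<in> E n (r n))"
  proof eventually_elim
    case (elim x)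
    show ?case
    proof
      assume "x \<in> B"
      show "\<exists>\<^sub>F n in sequentially. x \<in> E n (r n)"
        unfolding frequently_sequentially
      proof
        fix m
        obtain a where "a \<ge> m" "x \<in> space M - F a"
          using elim unfolding eventually_sequentially by (meson nle_le)
        then show "\<exists>n\<ge>m. x \<in> E n (r n)"
          using \<open>x \<in> B\<close> unfolding F_def by fastforce
      qed
    qed
  qed
  with r(1) show ?thesis by (rule that)
qed

text \<open>Weak convergence transfers the bound j on the sum of the p c to the expected number of
  thresholds passed on \<open>A0 j\<close>, but only for finitely many thresholds per function. The
  level \<open>c n\<close> is where counting stops for the n-th one.\<close>

lemma loc_L1_bounded_of_summable_thresholds:
  fixes g :: "nat \<Rightarrow> 'a \<Rightarrow> real"
  assumes g [measurable]: "\<And>m. g m \<in> borel_measurable M"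
    and p [measurable]: "\<And>c. p c \<in> borel_measurable M" and p01: "\<And>c x. 0 \<le> p c x" "\<And>c x. p c x \<le> 1"
    and weak: "\<And>c. weakly_tendsto M (\<lambda>m. indicator {x \<in> space M. real (Suc c) \<le> \<bar>g m x\<bar>}) (p c)"
    and summable: "AE x in M. \<exists>j. \<forall>C. (\<Sum>c<C. p c x) \<le> real j"
  obtains A and r :: "nat \<Rightarrow> nat" where "exhausting_seq M A" "strict_mono r" "loc_L1_bounded M (g \<circ> r) A"
proof -
  define E where "E c m = {x \<in> space M. real (Suc c) \<le> \<bar>g m x\<bar>}" for c m
  have E [measurable]: "E c m \<in> sets M" for c m unfolding E_def by measurable
  define I where "I c m = (indicator (E c m) :: 'a \<Rightarrow> real)" for c m
  define A0 where "A0 j = {x \<in> space M. \<forall>C. (\<Sum>c<C. p c x) \<le> real j}" for j :: nat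
  have A0 [measurable]: "A0 j \<in> sets M" for j unfolding A0_def by measurable
  have bdd_p: "bdd_measurable M (p c)" for c
    by (rule bdd_measurableI[of _ _ 1]) (use p p01 in auto)
  have bdd_I: "bdd_measurable M (I c m)" for c m
    unfolding I_def by (rule bdd_measurable_indicator) measurable
  note bdd = bdd_measurable_intros bdd_I bdd_p A0
  have weakD: "(\<lambda>m. \<integral>x. I c m x * h x \<partial>M) \<longlonglongrightarrow> (\<integral>x. p c x * h x \<partial>M)" if "bdd_measurable M h" for c h
    using weak that unfolding weakly_tendsto_def I_def E_def by blast
  \<comment> \<open>Almost everywhere the p c are terms of a convergent series, so they tend to 0,
    and 1 dominates them. This yields levels that are exceeded with arbitrarily small limiting
    probability.\<close>
  have "(\<lambda>c. \<integral>x. p c x \<partial>M) \<longlonglongrightarrow> (\<integral>x. 0 \<partial>M)"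
  proof (rule integral_dominated_convergence[where w = "\<lambda>_. 1"])
    show "AE x in M. (\<lambda>c. p c x) \<longlonglongrightarrow> 0"
      using summable
    proof eventually_elim
      case (elim x)
      then show ?case
        using p01 by (auto intro!: summable_LIMSEQ_zero summableI_nonneg_bounded)
    qed
  qed (use p01 in auto)
  then have ev: "\<forall>\<^sub>F c in sequentially. (\<integral>x. p c x \<partial>M) < (1/2)^n" for n
    by (rule order_tendstoD(2)) simp
  have "\<exists>c\<ge>n. (\<integral>x. p c x \<partial>M) < (1/2)^n" for n
    using eventually_happens[OF eventually_conj[OF eventually_ge_at_top[of n] ev[of n]]] by auto
  then obtain c where c: "\<And>n. c n \<ge> n" "\<And>n. (\<integral>x. p (c n) x \<partial>M) < (1/2)^n"
    by metis
  define T where "T n m x = (\<Sum>i<c n. I i m x)" for n m x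
  \<comment> \<open>\<open>I (c n) m\<close> marks the values that are at least c n + 1. Stage n can
    meet the demands for finitely many j only; for each j the functions with n < j are bounded
    through the definition of A.\<close>
  define P where "P n (\<rho> :: nat \<Rightarrow> nat) m \<longleftrightarrow> (\<integral>x. I (c n) m x \<partial>M) < (1/2)^n
      \<and> (\<forall>j\<in>{..n}. (\<integral>x. T n m x * indicator (A0 j) x \<partial>M) < real j + 1)" for n \<rho> m
  obtain r where r: "strict_mono r" "\<And>n. P n r (r n)"
  proof (rule strict_mono_select[of P])
    fix n :: nat and \<rho> :: "nat \<Rightarrow> nat"
    have "(\<lambda>m. \<integral>x. I (c n) m x * 1 \<partial>M) \<longlonglongrightarrow> (\<integral>x. p (c n) x * 1 \<partial>M)"
      by (intro weakD bdd)
    then have "\<forall>\<^sub>F m in sequentially. (\<integral>x. I (c n) m x \<partial>M) < (1/2)^n"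
      using c(2)[of n] by (intro order_tendstoD(2)) auto
    moreover have "\<forall>\<^sub>F m in sequentially. (\<integral>x. T n m x * indicator (A0 j) x \<partial>M) < real j + 1" for j
    proof (rule order_tendstoD(2))
      have i: "integrable M (\<lambda>x. I i m x * indicator (A0 j) x)" "integrable M (\<lambda>x. p i x * indicator (A0 j) x)" for i m
        by (intro integrable_bdd bdd)+
      have "(\<lambda>m. \<Sum>i<c n. \<integral>x. I i m x * indicator (A0 j) x \<partial>M)
          \<longlonglongrightarrow> (\<Sum>i<c n. \<integral>x. p i x * indicator (A0 j) x \<partial>M)"
        by (intro tendsto_sum weakD bdd)
      then show "(\<lambda>m. \<integral>x. T n m x * indicator (A0 j) x \<partial>M)
          \<longlonglongrightarrow> (\<integral>x. (\<Sum>i<c n. p i x) * indicator (A0 j) x \<partial>M)"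
        by (simp only: T_def sum_distrib_right Bochner_Integration.integral_sum[OF i(1)]
            Bochner_Integration.integral_sum[OF i(2)])
      have "(\<integral>x. (\<Sum>i<c n. p i x) * indicator (A0 j) x \<partial>M) \<le> (\<integral>x. real j \<partial>M)"
        by (intro integral_mono integrable_bdd bdd) (auto simp: A0_def indicator_def)
      then show "(\<integral>x. (\<Sum>i<c n. p i x) * indicator (A0 j) x \<partial>M) < real j + 1"
        by (simp add: prob_space)
    qed
    ultimately show "eventually (P n \<rho>) sequentially"
      unfolding P_def[abs_def] by (intro eventually_conj eventually_ball_finite) auto
  qed (auto simp: P_def)
  \<comment> \<open>For n \<ge> j the cap is c n + 1, because j \<le> n \<le> c n, so the counted
    thresholds suffice. For smaller n the cap j makes room, as j grows, for the finitely many
    excesses that almost every point has.\<close>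
  define A where "A j = A0 j \<inter> {x \<in> space M. \<forall>n. \<bar>g (r n) x\<bar> \<le> max (real (Suc (c n))) (real j)}" for j
  have A [measurable]: "A j \<in> sets M" for j unfolding A_def by measurable
  have small: "AE x in M. eventually (\<lambda>n. x \<in> space M - E (c n) (r n)) sequentially"
  proof (rule borel_cantelli_AE1)
    have "prob (E (c n) (r n)) \<le> (1/2)^n" for n
      using r(2)[of n] unfolding P_def by (simp add: I_def)
    then show "summable (\<lambda>n. prob (E (c n) (r n)))"
      by (intro summable_comparison_test'[OF summable_geometric[of "1/2"], of 0]) auto
  qed (auto simp: less_top[symmetric])
  have "exhausting_seq M A"
  proof (rule exhausting_seqI)
    show "incseq A"
    proof (intro monoI subsetI)
      fix i j :: nat and x assume "i \<le> j" and x: "x \<in> A i"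
      then have "real i \<le> real j" by simp
      then show "x \<in> A j"
        using x unfolding A_def A0_def by (auto intro: order_trans[OF _ max.mono[OF order_refl]] order_trans)
    qed
    show "AE x in M. \<exists>j. x \<in> A j"
      using summable small AE_space
    proof eventually_elim
      case (elim x)
      obtain j0 where j0: "\<And>C. (\<Sum>c<C. p c x) \<le> real j0" using elim by blast
      obtain n0 where n0: "\<And>n. n \<ge> n0 \<Longrightarrow> x \<notin> E (c n) (r n)"
        using elim unfolding eventually_sequentially by auto
      obtain j1 :: nat where j1: "(\<Sum>n<n0. \<bar>g (r n) x\<bar>) \<le> real j1"
        using real_arch_simple by blast
      have "\<bar>g (r n) x\<bar> \<le> max (real (Suc (c n))) (real (max j0 j1))" for n
      proof (cases "n < n0")
        case True
        then have "\<bar>g (r n) x\<bar> \<le> (\<Sum>n<n0. \<bar>g (r n) x\<bar>)"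
          by (intro member_le_sum) auto
        then show ?thesis using j1 by linarith
      next
        case False
        then show ?thesis using n0[of n] elim by (auto simp: E_def)
      qed
      moreover have "(\<Sum>c<C. p c x) \<le> real (max j0 j1)" for C
        using j0[of C] by linarith
      ultimately have "x \<in> A (max j0 j1)"
        using elim by (auto simp: A_def A0_def)
      then show ?case by blast
    qed
  qed (rule A)
  moreover have "loc_L1_bounded M (g \<circ> r) A"
    unfolding loc_L1_bounded_def
  proof
    fix j
    \<comment> \<open>The part j + 2 is 1 from the layer-cake bound plus j + 1 from P, for n \<ge>
      j; the sum dominates the caps of the first j functions.\<close>
    define D where "D = real j + 2 + (\<Sum>n<j. real (Suc (c n)))"
    have "(\<integral>\<^sup>+x. ennreal (\<bar>(g \<circ> r) n x\<bar> * indicator (A j) x) \<partial>M) \<le> ennreal D" for n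
    proof (cases "n < j")
      case True
      then have "real (Suc (c n)) \<le> (\<Sum>n<j. real (Suc (c n)))"
        by (intro member_le_sum) auto
      then have "max (real (Suc (c n))) (real j) \<le> D"
        unfolding D_def by linarith
      then have "(\<integral>\<^sup>+x. ennreal (\<bar>(g \<circ> r) n x\<bar> * indicator (A j) x) \<partial>M) \<le> (\<integral>\<^sup>+x. ennreal D \<partial>M)"
        by (intro nn_integral_mono ennreal_leI) (auto simp: A_def indicator_def intro: order_trans)
      then show ?thesis by (simp add: emeasure_space_1)
    next
      case False
      have bdd_T: "bdd_measurable M (\<lambda>x. 1 + T n (r n) x * indicator (A0 j) x)"
        unfolding T_def by (intro bdd)
      have T_nonneg: "T n (r n) x * indicator (A0 j) x \<ge> 0" for x
        unfolding T_def I_def by (intro mult_nonneg_nonneg sum_nonneg) auto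
      have "\<bar>g (r n) x\<bar> * indicator (A j) x \<le> 1 + T n (r n) x * indicator (A0 j) x" if "x \<in> space M" for x
      proof (cases "x \<in> A j")
        case True
        have "real j \<le> real (c n)" using False c(1)[of n] by simp
        moreover have "\<bar>g (r n) x\<bar> \<le> max (real (Suc (c n))) (real j)"
          using True unfolding A_def by blast
        ultimately have "\<bar>g (r n) x\<bar> \<le> 1 + real (c n)" by simp
        then have "\<bar>g (r n) x\<bar> \<le> 1 + (\<Sum>i<c n. of_bool (real (Suc i) \<le> \<bar>g (r n) x\<bar>))"
          by (rule le_Suc_sum_thresholds)
        also have "(\<Sum>i<c n. of_bool (real (Suc i) \<le> \<bar>g (r n) x\<bar>)) = T n (r n) x"
          unfolding T_def I_def E_def using that by (intro sum.cong) (auto simp: indicator_def)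
        finally show ?thesis using True by (auto simp: A_def)
      next
        case False
        then show ?thesis using T_nonneg[of x] by simp
      qed
      then have "(\<integral>\<^sup>+x. ennreal (\<bar>(g \<circ> r) n x\<bar> * indicator (A j) x) \<partial>M)
          \<le> (\<integral>\<^sup>+x. ennreal (1 + T n (r n) x * indicator (A0 j) x) \<partial>M)"
        by (intro nn_integral_mono ennreal_leI) auto
      also have "\<dots> = ennreal (\<integral>x. 1 + T n (r n) x * indicator (A0 j) x \<partial>M)"
        using T_nonneg by (intro nn_integral_eq_integral integrable_bdd bdd_T) (auto intro: add_nonneg_nonneg)
      also have "(\<integral>x. 1 + T n (r n) x * indicator (A0 j) x \<partial>M) = 1 + (\<integral>x. T n (r n) x * indicator (A0 j) x \<partial>M)"
      proof -
        have "integrable M (\<lambda>x. T n (r n) x * indicator (A0 j) x)"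
          unfolding T_def by (intro integrable_bdd bdd)
        then show ?thesis by (simp add: prob_space)
      qed
      also have "\<dots> \<le> 1 + (real j + 1)"
        using r(2)[of n, unfolded P_def, THEN conjunct2, rule_format, of j] False by simp
      also have "\<dots> \<le> D"
        unfolding D_def by (simp add: sum_nonneg)
      finally show ?thesis by (simp add: ennreal_leI)
    qed
    then have "(SUP n. \<integral>\<^sup>+x. ennreal (\<bar>(g \<circ> r) n x\<bar> * indicator (A j) x) \<partial>M) \<le> ennreal D"
      by (rule SUP_least)
    then show "(SUP n. \<integral>\<^sup>+x. ennreal (\<bar>(g \<circ> r) n x\<bar> * indicator (A j) x) \<partial>M) < \<infinity>"
      by (rule order.strict_trans1) simp
  qed
  ultimately show ?thesis using that r(1) by blast
qed

lemma loc_L1_bounded_of_hereditary_cesaro: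
  fixes h :: "nat \<Rightarrow> 'a \<Rightarrow> real"
  assumes h [measurable]: "\<And>m. h m \<in> borel_measurable M"
    and hered: "\<And>s. strict_mono s \<Longrightarrow> cesaro_ae M (h \<circ> s) fs"
  obtains A and r :: "nat \<Rightarrow> nat" where "exhausting_seq M A" "strict_mono r" "loc_L1_bounded M (h \<circ> r) A"
proof -
  define E where "E c m = {x \<in> space M. real (Suc c) \<le> \<bar>h m x\<bar>}" for c m
  have E [measurable]: "E c m \<in> sets M" for c m unfolding E_def by measurable
  have bdd_E: "bdd_measurable M (indicator (E c m))" for c m
    by (rule bdd_measurable_indicator) measurable
  obtain r1 :: "nat \<Rightarrow> nat" and p0 where r1: "strict_mono r1"
    and p0 [measurable]: "\<And>c. p0 c \<in> borel_measurable M" and p0_bd: "\<And>c x. \<bar>p0 c x\<bar> \<le> 1"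
    and weak0: "\<And>c. weakly_tendsto M (\<lambda>m. indicator (E c (r1 m))) (p0 c)"
    by (rule weakly_convergent_array[of "\<lambda>c m. indicator (E c m)" "\<lambda>_. 1"])
       (use bdd_E in \<open>auto simp: indicator_def\<close>)
  \<comment> \<open>The weak limits are nonnegative only almost everywhere, while
    \<open>weak_borel_cantelli\<close> asks for values in [0, 1] everywhere.\<close>
  define p where "p c x = max 0 (p0 c x)" for c x
  have p [measurable]: "p c \<in> borel_measurable M" for c unfolding p_def by measurable
  have p01: "0 \<le> p c x" "p c x \<le> 1" for c x
    using p0_bd[of c x] by (auto simp: p_def)
  have weak: "weakly_tendsto M (\<lambda>m. indicator (E c (r1 m))) (p c)" for c
  proof -
    have "AE x in M. 0 \<le> p0 c x"
      by (rule weakly_tendsto_mono[of "\<lambda>_ _. 0" "\<lambda>_. 0" "\<lambda>m. indicator (E c (r1 m))" "p0 c"])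
         (auto simp: weakly_tendsto_def[of M "\<lambda>_ _. 0"] weak0
           intro!: bdd_E bdd_measurable_const bdd_measurableI[OF p0 p0_bd])
    then have eq: "AE x in M. p c x = p0 c x"
      by eventually_elim (simp add: p_def)
    have "(\<integral>x. p c x * k x \<partial>M) = (\<integral>x. p0 c x * k x \<partial>M)" if "bdd_measurable M k" for k
      using eq bdd_measurable_borel[OF that] by (intro integral_cong_AE) auto
    then show ?thesis
      using weak0[of c] unfolding weakly_tendsto_def by simp
  qed
  define B where "B = {x \<in> space M. \<forall>j::nat. \<exists>C. real j < (\<Sum>c<C. p c x)}"
  have B: "B \<in> sets M" unfolding B_def by measurable
  obtain r2 :: "nat \<Rightarrow> nat" where r2: "strict_mono r2"
    and freq: "AE x in M. x \<in> B \<longrightarrow> (\<exists>\<^sub>F n in sequentially. x \<in> E n (r1 (r2 n)))"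
    by (rule weak_borel_cantelli[of "\<lambda>c m. E c (r1 m)" B p, OF E B p p01 weak])
       (auto simp: B_def)
  have "AE x in M. \<exists>j. \<forall>C. (\<Sum>c<C. p c x) \<le> real j"
    using freq hered[OF strict_mono_o[OF r1 r2]] AE_space unfolding cesaro_ae_def
  proof eventually_elim
    case (elim x)
    \<comment> \<open>Event n has threshold n + 1, which is also the divisor here, so a quotient
      below 1 in absolute value excludes it. This contradicts its occurring infinitely often on
      B.\<close>
    then have "(\<lambda>n. h (r1 (r2 n)) x / real (Suc n)) \<longlonglongrightarrow> 0"
      by (intro cesaro_tendsto_imp_term_0[where l = "fs x"]) (simp add: o_def)
    then have "\<forall>\<^sub>F n in sequentially. dist (h (r1 (r2 n)) x / real (Suc n)) 0 < 1"
      by (rule tendstoD) simp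
    then have "\<forall>\<^sub>F n in sequentially. x \<notin> E n (r1 (r2 n))"
      by eventually_elim (auto simp: E_def dist_real_def)
    then have "x \<notin> B"
      using elim(1) by (auto simp: frequently_def)
    then show ?case using elim(3) by (auto simp: B_def not_less)
  qed
  then obtain A and r :: "nat \<Rightarrow> nat" where
    "exhausting_seq M A" and r: "strict_mono r" and "loc_L1_bounded M ((\<lambda>m. h (r1 m)) \<circ> r) A"
    using loc_L1_bounded_of_summable_thresholds[of "\<lambda>m. h (r1 m)" p] weak p01
    unfolding E_def by (metis (no_types, lifting) h p)
  then show ?thesis
    using that[of A "r1 \<circ> r"] strict_mono_o[OF r1 r] by (simp add: o_def)
qed

end

theorem theorem2p1:
  fixes M :: "'a measure" and f :: "nat \<Rightarrow> 'a \<Rightarrow> real"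
  assumes "prob_space M"
    and "\<And>n. f n \<in> borel_measurable M"
  shows
   "(\<forall>(k::nat\<Rightarrow>nat) A. strict_mono k \<and> exhausting_seq M A \<and> loc_L1_bounded M (f \<circ> k) A \<longrightarrow>
       (\<exists>fs (r::nat\<Rightarrow>nat). fs \<in> borel_measurable M \<and> strict_mono r \<and>
          (\<forall>(s::nat\<Rightarrow>nat). strict_mono s \<longrightarrow> cesaro_ae M (f \<circ> k \<circ> r \<circ> s) fs)))
    \<and> (\<forall>(k::nat\<Rightarrow>nat) fs. strict_mono k \<and> fs \<in> borel_measurable M \<and>
          (\<forall>(s::nat\<Rightarrow>nat). strict_mono s \<longrightarrow> cesaro_ae M (f \<circ> k \<circ> s) fs) \<longrightarrow>
       (\<exists>A (r::nat\<Rightarrow>nat). exhausting_seq M A \<and> strict_mono r \<and> loc_L1_bounded M (f \<circ> k \<circ> r) A))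
    \<and> ((\<exists>(k::nat\<Rightarrow>nat) A. strict_mono k \<and> exhausting_seq M A \<and> loc_L1_bounded M (f \<circ> k) A) \<longleftrightarrow>
       (\<exists>Q (k::nat\<Rightarrow>nat). equiv_prob M Q \<and> strict_mono k \<and>
          (SUP n. \<integral>\<^sup>+ x. ennreal \<bar>f (k n) x\<bar> \<partial>Q) < \<infinity>))"
proof -
  interpret prob_space M by fact
  have meas: "(f \<circ> k) n \<in> borel_measurable M" for k :: "nat \<Rightarrow> nat" and n
    using assms(2) by simp
  have 1: "\<exists>fs (r::nat\<Rightarrow>nat). fs \<in> borel_measurable M \<and> strict_mono r \<and>
      (\<forall>(s::nat\<Rightarrow>nat). strict_mono s \<longrightarrow> cesaro_ae M (f \<circ> k \<circ> r \<circ> s) fs)"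
    if "exhausting_seq M A" "loc_L1_bounded M (f \<circ> k) A" for k A
    using komlos_of_loc_L1_bounded[OF meas that] by metis
  have 2: "\<exists>A (r::nat\<Rightarrow>nat). exhausting_seq M A \<and> strict_mono r \<and> loc_L1_bounded M (f \<circ> k \<circ> r) A"
    if "\<And>s. strict_mono s \<Longrightarrow> cesaro_ae M (f \<circ> k \<circ> s) fs" for k fs
    using loc_L1_bounded_of_hereditary_cesaro[of "f \<circ> k" fs, OF meas that] by metis
  have 3: "\<exists>Q. equiv_prob M Q \<and> (SUP n. \<integral>\<^sup>+ x. ennreal \<bar>f (k n) x\<bar> \<partial>Q) < \<infinity>"
    if "exhausting_seq M A" "loc_L1_bounded M (f \<circ> k) A" for k A
    using equiv_prob_of_loc_L1_bounded[OF meas that] by (auto simp: o_def)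
  have 4: "\<exists>A. exhausting_seq M A \<and> loc_L1_bounded M (f \<circ> k) A"
    if "equiv_prob M Q" "(SUP n. \<integral>\<^sup>+ x. ennreal \<bar>f (k n) x\<bar> \<partial>Q) < \<infinity>" for k Q
    using loc_L1_bounded_of_equiv_prob[of "f \<circ> k" Q, OF meas that(1)] that(2) by (auto simp: o_def)
  show ?thesis
    using 1 2 3 4 by blast
qed

end
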